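(* Let $\Omega,\Lambda\subset\mathbb{R}^n$ be smooth, open, connected, bounded domains such that some hyperplane separates $\Omega$ and $\Lambda$, and such that there is $\delta>0$ with $|x-y|\ge\delta$ for all $(x,y)\in\Omega\times\Lambda$. Let $f,g\in L^1(\mathbb{R}^n)$ be nonnegative with $\int f=\int g=1$, $\operatorname{spt} f=\overline\Omega$, $\operatorname{spt} g=\overline\Lambda$, and $\beta_1\le f\le\beta_2$ on $\Omega$, $\beta_1\le g\le\beta_2$ on $\Lambda$ for some constants $\beta_1,\beta_2>0$. Let $c(x,y)=\tfrac12|x-y|^2$. Let $0<\lambda_1<\lambda_2$ be such that the transported masses satisfy $0<m(\lambda_1)<m(\lambda_2)<1$, and let $u_{\lambda_1},u_{\lambda_2}$ be the normalized potentials of the optimal partial transport problems with parameters $\lambda_1,\lambda_2$, respectively. Then $u_{\lambda_1}\le u_{\lambda_2}$ in $\Omega$.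
   Context: $\Gamma_{\le}(f,g)$ is the set of (nonnegative) Borel measures on $\mathbb{R}^n\times\mathbb{R}^n$ whose left and right marginals are dominated by $f\,dx$ and $g\,dy$. For $\lambda>0$, $\gamma_\lambda$ is the unique minimizer of $\int(c(x,y)-\lambda)\,d\gamma$ over $\gamma\in\Gamma_{\le}(f,g)$, and $m(\lambda)$ is its total mass. Augmentation by a point at infinity: let $\hat{\mathbb{R}}^n=\mathbb{R}^n\cup\{\hat\infty\}$, and set $\hat c(x,y)=c(x,y)-\lambda$ if $x\ne\hat\infty$ and $y\neq\hat\infty$, and $\hat c(x,y)=0$ otherwise. Let $\hat\mu=f\,dx+\|g\|_{L^1}\delta_{\hat\infty}$ and $\hat\nu=g\,dy+\|f\|_{L^1}\delta_{\hat\infty}$. Minimizing $\int\hat c\,d\hat\gamma$ over Borel measures $\hat\gamma$ on $\hat{\mathbb{R}}^n\times\hat{\mathbb{R}}^n$ with marginals $\hat\mu,\hat\nu$ is equivalent to the partial transport problem with parameter $\lambda$, i.e. to minimizing $\int_{\mathbb{R}^n\times\mathbb{R}^n}(c(x,y)-\lambda)\,d\gamma$ over $\gamma\in\Gamma_{\le}(f,g)$; $\gamma_\lambda$ is the restriction of the minimizer to $\mathbb{R}^n\times\mathbb{R}^n$. A function $\hat u:\hat{\mathbb{R}}^n\to(-\infty,\infty]$ is $\hat c$-convex if it is not identically $\infty$ on $\operatorname{spt}\hat\mu$ and $\hat u(x)=\sup_{y\in\operatorname{spt}\hat\nu}\big(-\hat c(x,y)-\hat u^{\hat c}(y)\big)$,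 where $\hat u^{\hat c}(y)=\sup_{x\in\operatorname{spt}\hat\mu}\big(-\hat c(x,y)-\hat u(x)\big)$. Its $\hat c$-subdifferential is $\partial^{\hat c}\hat u=\{(x,y)\in\hat{\mathbb{R}}^n\times\hat{\mathbb{R}}^n:\hat u(x)+\hat u^{\hat c}(y)=-\hat c(x,y)\}$. It is known (Caffarelli–McCann) that there is a $\hat c$-convex function $\hat u_\lambda$, unique up to additive constants, such that $\operatorname{spt}\hat\gamma\subset\partial^{\hat c}\hat u_\lambda$ for every minimizer $\hat\gamma$ of the augmented problem. It is normalized by $\hat u_\lambda(\hat\infty)=0$. The normalized potential $u_\lambda$ is the restriction of this normalized $\hat u_\lambda$ to $\mathbb{R}^n$. *)

theory Defs
  imports "HOL-Analysis.Analysis"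
begin

fun Ck_on :: "nat \<Rightarrow> ('a::euclidean_space \<Rightarrow> real) \<Rightarrow> 'a set \<Rightarrow> bool" where
  "Ck_on 0 \<phi> U \<longleftrightarrow> continuous_on U \<phi>"
| "Ck_on (Suc k) \<phi> U \<longleftrightarrow> \<phi> differentiable_on U \<and>
     (\<forall>i\<in>Basis. Ck_on k (\<lambda>x. frechet_derivative \<phi> (at x) i) U)"

definition smooth_on :: "('a::euclidean_space \<Rightarrow> real) \<Rightarrow> 'a set \<Rightarrow> bool" where
  "smooth_on \<phi> U \<longleftrightarrow> (\<forall>k. Ck_on k \<phi> U)"

text \<open>The non-vanishing differential makes \<open>frontier S \<inter> U\<close> the smooth hypersurface
  \<open>{x \<in> U. \<phi> x = 0}\<close>, with \<open>S\<close> lying on one side of it.\<close>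

definition smooth_boundary :: "'a::euclidean_space set \<Rightarrow> bool" where
  "smooth_boundary S \<longleftrightarrow> (\<forall>p\<in>frontier S. \<exists>U \<phi>. open U \<and> p \<in> U \<and> smooth_on \<phi> U \<and>
     (\<forall>x\<in>U. frechet_derivative \<phi> (at x) \<noteq> (\<lambda>_. 0)) \<and>
     S \<inter> U = {x \<in> U. \<phi> x < 0})"

definition smooth_bounded_domain :: "'a::euclidean_space set \<Rightarrow> bool" where
  "smooth_bounded_domain S \<longleftrightarrow> open S \<and> connected S \<and> bounded S \<and> S \<noteq> {} \<and> smooth_boundary S"

definition hyperplane_separates :: "'a::euclidean_space set \<Rightarrow> 'a set \<Rightarrow> bool" where
  "hyperplane_separates S T \<longleftrightarrow>
     (\<exists>a b. a \<noteq> 0 \<and> (\<forall>x\<in>S. a \<bullet> x \<le> b) \<and> (\<forall>y\<in>T. b \<le> a \<bullet> y))"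

definition spt :: "'a::topological_space measure \<Rightarrow> 'a set" where
  "spt M = {x. \<forall>U. open U \<and> x \<in> U \<longrightarrow> emeasure M U > 0}"

abbreviation measure_of_density :: "('a::euclidean_space \<Rightarrow> real) \<Rightarrow> 'a measure" where
  "measure_of_density f \<equiv> density lborel (\<lambda>x. ennreal (f x))"

definition cost :: "'a::euclidean_space \<Rightarrow> 'a \<Rightarrow> real" where
  "cost x y = (norm (x - y))\<^sup>2 / 2"

definition partial_plans ::
  "('a::euclidean_space \<Rightarrow> real) \<Rightarrow> ('a \<Rightarrow> real) \<Rightarrow> ('a \<times> 'a) measure set" where
  "partial_plans f g = {\<gamma>. sets \<gamma> = sets borel \<and>
     (\<forall>A\<in>sets borel. emeasure (distr \<gamma> borel fst) A \<le> emeasure (measure_of_density f) A) \<and>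
     (\<forall>A\<in>sets borel. emeasure (distr \<gamma> borel snd) A \<le> emeasure (measure_of_density g) A)}"

text \<open>When \<open>f\<close> and \<open>g\<close> are integrable with bounded support, the cost is bounded almost everywhere
  with respect to every admissible plan, so the Bochner integrals here and below are genuine.\<close>

definition optimal_partial_plan ::
  "('a::euclidean_space \<Rightarrow> real) \<Rightarrow> ('a \<Rightarrow> real) \<Rightarrow> real \<Rightarrow> ('a \<times> 'a) measure \<Rightarrow> bool" where
  "optimal_partial_plan f g lam \<gamma> \<longleftrightarrow>
     is_arg_min (\<lambda>\<gamma>'. \<integral>p. (cost (fst p) (snd p) - lam) \<partial>\<gamma>') (\<lambda>\<gamma>'. \<gamma>' \<in> partial_plans f g) \<gamma>"

text \<open>The topology below makes the added point at infinity an isolated point.\<close>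

datatype 'a aug = Fin 'a | Infty

instantiation aug :: (topological_space) topological_space
begin

definition open_aug :: "'a aug set \<Rightarrow> bool" where
  "open_aug U \<longleftrightarrow> open (Fin -` U)"

instance
proof
  show "open (UNIV :: 'a aug set)"
    by (simp add: open_aug_def)
  show "open (S \<inter> T)" if "open S" "open T" for S T :: "'a aug set"
    using that by (simp add: open_aug_def open_Int)
  show "open (\<Union>K)" if "\<forall>S\<in>K. open S" for K :: "'a aug set set"
    using that by (auto simp: open_aug_def vimage_Union)
qed

end

lemma continuous_on_Fin: "continuous_on S Fin"
  by (rule continuous_on_subset[of UNIV]) (auto simp: continuous_on_open_vimage open_aug_def)

lemma measurable_Fin [measurable]: "Fin \<in> borel_measurable borel"
  by (intro borel_measurable_continuous_onI continuous_on_Fin)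

definition aug_cost :: "real \<Rightarrow> 'a::euclidean_space aug \<Rightarrow> 'a aug \<Rightarrow> real" where
  "aug_cost lam x y = (case (x, y) of (Fin a, Fin b) \<Rightarrow> cost a b - lam | _ \<Rightarrow> 0)"

text \<open>\<open>aug_measure f r\<close> is \<open>f dx\<close> plus \<open>r\<close> times the Dirac mass at infinity.\<close>

definition aug_measure :: "('a::euclidean_space \<Rightarrow> real) \<Rightarrow> real \<Rightarrow> 'a aug measure" where
  "aug_measure f r = measure_of UNIV (sets borel)
     (\<lambda>A. emeasure (measure_of_density f) (Fin -` A) + ennreal r * indicator A Infty)"

lemma space_aug_measure [simp]: "space (aug_measure f r) = UNIV"
  by (simp add: aug_measure_def space_measure_of_conv)

lemma sets_aug_measure [simp, measurable_cong]: "sets (aug_measure f r) = sets borel"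
proof -
  have "sigma_sets UNIV (sets (borel :: 'a aug measure)) = sets borel"
    using sets.sigma_sets_eq[of "borel :: 'a aug measure"] by simp
  then show ?thesis
    by (simp add: aug_measure_def sets_measure_of_conv)
qed

lemma emeasure_aug_measure:
  assumes A: "A \<in> sets borel"
  shows "emeasure (aug_measure f r) A =
           emeasure (measure_of_density f) (Fin -` A) + ennreal r * indicator A Infty"
proof -
  let ?M = "distr (measure_of_density f) borel Fin"
  let ?\<mu> = "\<lambda>A. emeasure (measure_of_density f) (Fin -` A) + ennreal r * indicator A Infty"
  have M: "emeasure ?M A = emeasure (measure_of_density f) (Fin -` A)"
    if "A \<in> sets borel" for A :: "'a aug set"
    using that by (subst emeasure_distr) auto
  have "countably_additive (sets borel) ?\<mu>"
  proof (rule countably_additiveI)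
    fix B :: "nat \<Rightarrow> 'a aug set"
    assume B: "range B \<subseteq> sets borel" "disjoint_family B" "(\<Union>i. B i) \<in> sets borel"
    have "(\<Sum>i. ?\<mu> (B i)) = (\<Sum>i. emeasure ?M (B i)) + (\<Sum>i. ennreal r * indicator (B i) Infty)"
      using B by (subst suminf_add) (auto simp: M image_subset_iff)
    also have "(\<Sum>i. emeasure ?M (B i)) = emeasure ?M (\<Union>i. B i)"
      using B by (intro suminf_emeasure) auto
    also have "(\<Sum>i. ennreal r * indicator (B i) Infty) = ennreal r * indicator (\<Union>i. B i) Infty"
      using B by (simp add: suminf_indicator)
    finally show "(\<Sum>i. ?\<mu> (B i)) = ?\<mu> (\<Union>i. B i)"
      using B by (simp add: M)
  qed
  then show ?thesis
    using A
    by (intro emeasure_measure_of[OF aug_measure_def])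
       (auto simp: positive_def)
qed

definition couplings ::
  "'a::topological_space measure \<Rightarrow> 'b::topological_space measure \<Rightarrow> ('a \<times> 'b) measure set" where
  "couplings \<mu> \<nu> = {\<gamma>. sets \<gamma> = sets borel \<and> distr \<gamma> borel fst = \<mu> \<and> distr \<gamma> borel snd = \<nu>}"

definition optimal_coupling ::
  "('a::topological_space \<Rightarrow> 'b::topological_space \<Rightarrow> real) \<Rightarrow> 'a measure \<Rightarrow> 'b measure
     \<Rightarrow> ('a \<times> 'b) measure \<Rightarrow> bool" where
  "optimal_coupling C \<mu> \<nu> \<gamma> \<longleftrightarrow>
     is_arg_min (\<lambda>\<gamma>'. \<integral>p. C (fst p) (snd p) \<partial>\<gamma>') (\<lambda>\<gamma>'. \<gamma>' \<in> couplings \<mu> \<nu>) \<gamma>"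

definition c_transform ::
  "('a::topological_space \<Rightarrow> 'b \<Rightarrow> real) \<Rightarrow> 'a measure \<Rightarrow> ('a \<Rightarrow> ereal) \<Rightarrow> 'b \<Rightarrow> ereal" where
  "c_transform C \<mu> u y = (SUP x\<in>spt \<mu>. - ereal (C x y) - u x)"

definition c_convex ::
  "('a::topological_space \<Rightarrow> 'b::topological_space \<Rightarrow> real) \<Rightarrow> 'a measure \<Rightarrow> 'b measure
     \<Rightarrow> ('a \<Rightarrow> ereal) \<Rightarrow> bool" where
  "c_convex C \<mu> \<nu> u \<longleftrightarrow>
     (\<forall>x. u x \<noteq> -\<infinity>) \<and> (\<exists>x\<in>spt \<mu>. u x \<noteq> \<infinity>) \<and>
     (\<forall>x. u x = (SUP y\<in>spt \<nu>. - ereal (C x y) - c_transform C \<mu> u y))"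

definition c_subdifferential ::
  "('a::topological_space \<Rightarrow> 'b \<Rightarrow> real) \<Rightarrow> 'a measure \<Rightarrow> ('a \<Rightarrow> ereal) \<Rightarrow> ('a \<times> 'b) set" where
  "c_subdifferential C \<mu> u = {(x, y). u x + c_transform C \<mu> u y = - ereal (C x y)}"

definition aug_source :: "('a::euclidean_space \<Rightarrow> real) \<Rightarrow> ('a \<Rightarrow> real) \<Rightarrow> 'a aug measure" where
  "aug_source f g = aug_measure f (\<integral>y. \<bar>g y\<bar> \<partial>lborel)"

definition aug_target :: "('a::euclidean_space \<Rightarrow> real) \<Rightarrow> ('a \<Rightarrow> real) \<Rightarrow> 'a aug measure" where
  "aug_target f g = aug_measure g (\<integral>x. \<bar>f x\<bar> \<partial>lborel)"

definition normalized_aug_potential ::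
  "('a::euclidean_space \<Rightarrow> real) \<Rightarrow> ('a \<Rightarrow> real) \<Rightarrow> real \<Rightarrow> ('a aug \<Rightarrow> ereal) \<Rightarrow> bool" where
  "normalized_aug_potential f g lam U \<longleftrightarrow>
     c_convex (aug_cost lam) (aug_source f g) (aug_target f g) U \<and>
     (\<forall>\<gamma>. optimal_coupling (aug_cost lam) (aug_source f g) (aug_target f g) \<gamma>
        \<longrightarrow> spt \<gamma> \<subseteq> c_subdifferential (aug_cost lam) (aug_source f g) U) \<and>
     U Infty = 0"

definition normalized_potential ::
  "('a::euclidean_space \<Rightarrow> real) \<Rightarrow> ('a \<Rightarrow> real) \<Rightarrow> real \<Rightarrow> ('a \<Rightarrow> ereal) \<Rightarrow> bool" where
  "normalized_potential f g lam u \<longleftrightarrow> (\<exists>U. normalized_aug_potential f g lam U \<and> u = U \<circ> Fin)"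

end

theory Submission
  imports Defs
begin

text \<open>
  Completing a partial plan by sending the untransported mass to infinity gives an optimal augmented
  coupling \<open>G\<^sub>i\<close> for each parameter. As it charges \<open>(\<infinity>, \<infinity>)\<close>, both potentials \<open>p\<^sub>i\<close> and
  \<open>q\<^sub>i\<close> vanish at infinity and are nonnegative; as some mass of the source stays, \<open>p\<^sub>1\<close> has a zero in
  the closure of \<open>\<Omega>\<close>.

  Let \<open>E\<^sub>t = {p\<^sub>1 - p\<^sub>2 > t}\<close> and \<open>F\<^sub>t = {q\<^sub>2 - q\<^sub>1 - (lam\<^sub>2 - lam\<^sub>1) > t}\<close> with \<open>t \<ge> 0\<close>. Duality shows
  that \<open>G\<^sub>1\<close> sends \<open>E\<^sub>t\<close> into \<open>F\<^sub>t\<close> and that everything \<open>G\<^sub>2\<close> sends to \<open>F\<^sub>t\<close> comes from \<open>E\<^sub>t\<close>, so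
  both sets have the same mass. Hence \<open>G\<^sub>1\<close>-almost every \<open>(x, y)\<close> with \<open>x \<in> E\<^sub>0\<close> is a contact point
  for both parameters, and by compactness every \<open>x \<in> E\<^sub>0 \<inter> \<Omega>\<close> has a common contact point \<open>y\<close>. So the
  convex functions \<open>p\<^sub>i + |x|\<^sup>2/2\<close> share a subgradient at every point of \<open>E\<^sub>0 \<inter> \<Omega>\<close>, and
  \<open>p\<^sub>1 - p\<^sub>2\<close> is locally constant there. If \<open>E\<^sub>0 \<inter> \<Omega>\<close> were nonempty, connectedness of \<open>\<Omega>\<close> would make
  \<open>p\<^sub>1 - p\<^sub>2\<close> a positive constant on the closure of \<open>\<Omega>\<close>, contradicting the zero of \<open>p\<^sub>1\<close>.
\<close>

subsection \<open>Supports and couplings\<close>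

text \<open>Second countability of the augmented space is what lets \<open>AE_in_spt\<close> and
  \<open>borel_prod\<close> be applied there. Images of basic sets together with the isolated point
  form a countable basis.\<close>

instance aug :: (second_countable_topology) second_countable_topology
proof
  obtain B :: "'a set set" where B: "countable B" "topological_basis B"
    using ex_countable_basis by auto
  let ?B = "insert {Infty} ((`) Fin ` B)"
  have "topological_basis ?B"
  proof (rule topological_basisI)
    show "open U" if "U \<in> ?B" for U
    proof -
      have "Fin -` {Infty} = ({} :: 'a set)" by auto
      then show ?thesis
        using that topological_basis_open[OF B(2)]
        by (auto simp: open_aug_def inj_vimage_image_eq inj_def)
    qed
  next
    fix U :: "'a aug set" and a
    assume U: "open U" "a \<in> U"
    show "\<exists>V\<in>?B. a \<in> V \<and> V \<subseteq> U"
    proof (cases a)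
      case (Fin x)
      then have "open (Fin -` U)" "x \<in> Fin -` U"
        using U by (simp_all add: open_aug_def)
      then obtain b where "b \<in> B" "x \<in> b" "b \<subseteq> Fin -` U"
        by (rule topological_basisE[OF B(2)])
      then show ?thesis
        using Fin by (intro bexI[of _ "Fin ` b"]) auto
    qed (use U in auto)
  qed
  moreover have "countable ?B"
    using B by auto
  ultimately show "\<exists>B::'a aug set set. countable B \<and> open = generate_topology B"
    by (blast intro: topological_basis_imp_subbasis)
qed

text \<open>The complement of the support is a union of open null sets. By Lindelof a countable
  subfamily has the same union, so the complement is null.\<close>

lemma AE_in_spt:
  fixes M :: "'a::second_countable_topology measure"
  assumes M: "sets M = sets borel"
  shows "AE x in M. x \<in> spt M"
proof -
  let ?F = "{U. open U \<and> emeasure M U = 0}"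
  obtain F where F: "F \<subseteq> ?F" "countable F" "\<Union>F = \<Union>?F"
    using Lindelof[of ?F] by blast
  have "(\<Union>U\<in>F. U) \<in> null_sets M"
    using F(1,2) by (intro null_sets_UN') (auto simp: null_sets_def M)
  moreover have "{x \<in> space M. x \<notin> spt M} \<subseteq> (\<Union>U\<in>F. U)"
    using F(3) by (auto simp: spt_def)
  ultimately show ?thesis
    by (rule AE_I')
qed

lemma emeasure_positive_meets_spt:
  fixes M :: "'a::second_countable_topology measure"
  assumes M: "sets M = sets borel" and A: "A \<in> sets borel" "0 < emeasure M A"
    and P: "AE x in M. P x"
  obtains x where "x \<in> A" "x \<in> spt M" "P x"
proof -
  have "\<not> (AE x in M. x \<notin> A)"
    using A AE_iff_measurable[of A M "\<lambda>x. x \<notin> A"] sets_eq_imp_space_eq[OF M] M by auto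
  moreover have "AE x in M. x \<notin> A" if "\<nexists>x. x \<in> A \<and> x \<in> spt M \<and> P x"
    using AE_in_spt[OF M] P by eventually_elim (use that in auto)
  ultimately show ?thesis
    using that by blast
qed

lemma couplingsD:
  assumes "\<gamma> \<in> couplings \<mu> \<nu>"
  shows "sets \<gamma> = sets borel" "space \<gamma> = UNIV"
    and "A \<in> sets borel \<Longrightarrow> emeasure \<gamma> (A \<times> UNIV) = emeasure \<mu> A"
    and "B \<in> sets borel \<Longrightarrow> emeasure \<gamma> (UNIV \<times> B) = emeasure \<nu> B"
proof -
  show 1: "sets \<gamma> = sets borel" and 2: "space \<gamma> = UNIV"
    using assms sets_eq_imp_space_eq[of \<gamma> borel] by (auto simp: couplings_def)
  have meas: "fst \<in> measurable \<gamma> borel" "snd \<in> measurable \<gamma> borel"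
    using 1 by (auto simp: measurable_cong_sets[OF 1 refl]
        intro!: borel_measurable_continuous_onI continuous_intros)
  show "emeasure \<gamma> (A \<times> UNIV) = emeasure \<mu> A" if "A \<in> sets borel"
  proof -
    have "emeasure \<mu> A = emeasure (distr \<gamma> borel fst) A"
      using assms by (simp add: couplings_def)
    also have "\<dots> = emeasure \<gamma> (fst -` A \<inter> space \<gamma>)"
      by (rule emeasure_distr[OF meas(1) that])
    finally show ?thesis by (simp add: 2 fst_vimage_eq_Times)
  qed
  show "emeasure \<gamma> (UNIV \<times> B) = emeasure \<nu> B" if "B \<in> sets borel"
  proof -
    have "emeasure \<nu> B = emeasure (distr \<gamma> borel snd) B"
      using assms by (simp add: couplings_def)
    also have "\<dots> = emeasure \<gamma> (snd -` B \<inter> space \<gamma>)"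
      by (rule emeasure_distr[OF meas(2) that])
    finally show ?thesis by (simp add: 2 snd_vimage_eq_Times)
  qed
qed

lemma spt_coupling_subset:
  assumes "\<gamma> \<in> couplings \<mu> \<nu>"
  shows "spt \<gamma> \<subseteq> spt \<mu> \<times> spt \<nu>"
proof clarify
  fix x y assume xy: "(x, y) \<in> spt \<gamma>"
  have "0 < emeasure \<mu> U" if "open U" "x \<in> U" for U
  proof -
    have "0 < emeasure \<gamma> (U \<times> UNIV)"
      using xy that by (auto simp: spt_def open_Times)
    then show ?thesis using couplingsD(3)[OF assms] that by simp
  qed
  moreover have "0 < emeasure \<nu> U" if "open U" "y \<in> U" for U
  proof -
    have "0 < emeasure \<gamma> (UNIV \<times> U)"
      using xy that by (auto simp: spt_def open_Times)
    then show ?thesis using couplingsD(4)[OF assms] that by simp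
  qed
  ultimately show "x \<in> spt \<mu> \<and> y \<in> spt \<nu>"
    by (auto simp: spt_def)
qed

text \<open>Mass balance: \<gamma>1 puts \<nu>(F) into the cylinder over F, \<gamma>2 shows \<nu>(F)
  \<le> \<mu>(E), and \<gamma>1 carries all of \<mu>(E) into E \<times> F. All inequalities are
  therefore equalities, and finiteness allows subtraction: \<gamma>1 sends nothing into F from
  outside E.\<close>

lemma coupling_exchange:
  fixes \<gamma>\<^sub>1 \<gamma>\<^sub>2 :: "('a::second_countable_topology \<times> 'b::second_countable_topology) measure"
  assumes \<gamma>: "\<gamma>\<^sub>1 \<in> couplings \<mu> \<nu>" "\<gamma>\<^sub>2 \<in> couplings \<mu> \<nu>" and fin: "emeasure \<mu> UNIV < \<infinity>"
    and E: "E \<in> sets borel" and F: "F \<in> sets borel"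
    and 1: "AE p in \<gamma>\<^sub>1. fst p \<in> E \<longrightarrow> snd p \<in> F"
    and 2: "AE p in \<gamma>\<^sub>2. snd p \<in> F \<longrightarrow> fst p \<in> E"
  shows "AE p in \<gamma>\<^sub>1. snd p \<in> F \<longrightarrow> fst p \<in> E"
proof -
  note c1 = couplingsD[OF \<gamma>(1)] and c2 = couplingsD[OF \<gamma>(2)]
  have meas: "A \<times> B \<in> sets borel" if "A \<in> sets borel" "B \<in> sets borel" for A :: "'a set" and B :: "'b set"
    using that by (simp add: borel_prod[symmetric])
  have S: "E \<times> F \<in> sets \<gamma>\<^sub>1" "E \<times> UNIV \<in> sets \<gamma>\<^sub>1" "UNIV \<times> F \<in> sets \<gamma>\<^sub>1"
    "E \<times> F \<in> sets \<gamma>\<^sub>2" "E \<times> UNIV \<in> sets \<gamma>\<^sub>2" "UNIV \<times> F \<in> sets \<gamma>\<^sub>2"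
    using E F by (auto simp: c1 c2 intro!: meas)
  have "emeasure \<gamma>\<^sub>1 (UNIV \<times> F) = emeasure \<gamma>\<^sub>2 (UNIV \<times> F)"
    using F by (simp add: c1 c2)
  also have "\<dots> \<le> emeasure \<gamma>\<^sub>2 (E \<times> UNIV)"
    by (rule emeasure_mono_AE[OF _ S(5)]) (use 2 in \<open>eventually_elim, auto\<close>)
  also have "\<dots> = emeasure \<gamma>\<^sub>1 (E \<times> UNIV)"
    using E by (simp add: c1 c2)
  also have "\<dots> \<le> emeasure \<gamma>\<^sub>1 (E \<times> F)"
    by (rule emeasure_mono_AE[OF _ S(1)]) (use 1 in \<open>eventually_elim, auto\<close>)
  finally have le: "emeasure \<gamma>\<^sub>1 (UNIV \<times> F) \<le> emeasure \<gamma>\<^sub>1 (E \<times> F)" .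
  have "emeasure \<gamma>\<^sub>1 (E \<times> F) \<le> emeasure \<gamma>\<^sub>1 (UNIV \<times> UNIV)"
    by (rule emeasure_mono) (use meas[of UNIV UNIV] c1 in auto)
  also have "\<dots> < \<infinity>"
    using fin c1(3)[of UNIV] by simp
  finally have fin': "emeasure \<gamma>\<^sub>1 (E \<times> F) \<noteq> \<infinity>" by simp
  have "emeasure \<gamma>\<^sub>1 (UNIV \<times> F - E \<times> F) = emeasure \<gamma>\<^sub>1 (UNIV \<times> F) - emeasure \<gamma>\<^sub>1 (E \<times> F)"
    using S fin' by (intro emeasure_Diff) auto
  also have "\<dots> = 0"
    using le fin' by (subst diff_eq_0_iff_ennreal) (auto simp: top_unique less_top)
  finally have "UNIV \<times> F - E \<times> F \<in> null_sets \<gamma>\<^sub>1"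
    using S by (auto simp: null_sets_def)
  then show ?thesis
    by (rule AE_I') auto
qed

section \<open>Topology and measures on the augmented space\<close>

lemma open_range_Fin: "open (range Fin)"
  by (simp add: open_aug_def vimage_def)

lemma open_image_Fin: "open A \<Longrightarrow> open (Fin ` A)"
  by (simp add: open_aug_def inj_vimage_image_eq inj_def)

lemma open_Infty: "open {Infty :: 'a::topological_space aug}"
proof -
  have "Fin -` {Infty} = ({} :: 'a set)" by auto
  then show ?thesis by (simp add: open_aug_def)
qed

text \<open>A left inverse of \<open>Fin\<close>. Because \<open>Infty\<close> is isolated, the
  arbitrary value there cannot spoil continuity.\<close>

definition the_fin :: "'a aug \<Rightarrow> 'a" where
  "the_fin a = (case a of Fin x \<Rightarrow> x | Infty \<Rightarrow> undefined)"

lemma the_fin_Fin [simp]: "the_fin (Fin x) = x"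
  by (simp add: the_fin_def)

lemma continuous_on_the_fin: "continuous_on S the_fin"
  by (rule continuous_on_subset[of UNIV])
     (auto simp: continuous_on_open_vimage open_aug_def vimage_def)

lemma sets_image_Fin:
  assumes "A \<in> sets borel"
  shows "Fin ` A \<in> sets borel"
proof -
  have "the_fin -` A \<inter> range Fin = Fin ` A"
    by force
  moreover have "the_fin -` A \<inter> range Fin \<in> sets borel"
    using measurable_sets[OF borel_measurable_continuous_onI[OF continuous_on_the_fin] assms]
      borel_open[OF open_range_Fin] by auto
  ultimately show ?thesis by metis
qed

lemma Fin_in_spt_aug_measure: "Fin x \<in> spt (aug_measure f r) \<longleftrightarrow> x \<in> spt (measure_of_density f)"
proof
  assume L: "Fin x \<in> spt (aug_measure f r)"
  show "x \<in> spt (measure_of_density f)"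
    unfolding spt_def
  proof (intro CollectI allI impI, elim conjE)
    fix U assume U: "open U" "x \<in> U"
    have "0 < emeasure (aug_measure f r) (Fin ` U)"
      using L U by (auto simp: spt_def open_image_Fin)
    also have "\<dots> = emeasure (measure_of_density f) U"
      using U by (subst emeasure_aug_measure)
        (auto simp: borel_open open_image_Fin inj_vimage_image_eq inj_def indicator_def)
    finally show "0 < emeasure (measure_of_density f) U" .
  qed
next
  assume R: "x \<in> spt (measure_of_density f)"
  show "Fin x \<in> spt (aug_measure f r)"
    unfolding spt_def
  proof (intro CollectI allI impI, elim conjE)
    fix U :: "'a aug set" assume U: "open U" "Fin x \<in> U"
    have "0 < emeasure (measure_of_density f) (Fin -` U)"
      using R U by (auto simp: spt_def open_aug_def)
    also have "\<dots> \<le> emeasure (aug_measure f r) U"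
      using U by (subst emeasure_aug_measure) (auto simp: borel_open)
    finally show "0 < emeasure (aug_measure f r) U" .
  qed
qed

lemma Infty_in_spt_aug_measure: "0 < r \<Longrightarrow> Infty \<in> spt (aug_measure f r)"
  by (auto simp: spt_def emeasure_aug_measure borel_open add_nonneg_pos)

subsection \<open>Functions with common supports\<close>

lemma cost_commute: "cost x y = cost y x"
  by (simp add: cost_def norm_minus_commute)

lemma cost_nonneg: "0 \<le> cost x y"
  by (simp add: cost_def)

text \<open>The quadratic term in y cancels, so the difference is affine in y. Both the continuity
  estimate and the subgradient inequalities below rest on this.\<close>

lemma cost_diff: "cost a y - cost b y = (a \<bullet> a - b \<bullet> b) / 2 + (b - a) \<bullet> y"
  by (simp add: cost_def power2_norm_eq_inner inner_diff_left inner_diff_right inner_commute field_simps)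

text \<open>The hypotheses say that p x is the supremum of 0 and all
  \<open>lam - cost x y - q y\<close> with y in T. As T is bounded, these functions of x share one
  modulus of continuity, which the supremum inherits.\<close>

lemma continuous_on_sup_cost:
  fixes p q :: "'a::euclidean_space \<Rightarrow> real"
  assumes T: "bounded T" and p0: "\<And>x. 0 \<le> p x"
    and ub: "\<And>x y. y \<in> T \<Longrightarrow> lam - cost x y - q y \<le> p x"
    and lub: "\<And>x K. 0 \<le> K \<Longrightarrow> (\<And>y. y \<in> T \<Longrightarrow> lam - cost x y - q y \<le> K) \<Longrightarrow> p x \<le> K"
  shows "continuous_on S p"
proof -
  obtain R where R: "0 < R" "\<And>y. y \<in> T \<Longrightarrow> norm y \<le> R"
    using T bounded_pos[of T] by auto
  \<comment> \<open>The common modulus: \<open>cost_diff\<close> estimated by Cauchy-Schwarz with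
    |y| \<le> R.\<close>
  define B where "B x x' = \<bar>x \<bullet> x - x' \<bullet> x'\<bar> / 2 + norm (x' - x) * R" for x x' :: 'a
  have B: "\<bar>cost x' y - cost x y\<bar> \<le> B x x'" if "y \<in> T" for x x' y
  proof -
    have "cost x' y - cost x y = (x' \<bullet> x' - x \<bullet> x) / 2 + (x - x') \<bullet> y"
      by (rule cost_diff)
    moreover have "\<bar>(x - x') \<bullet> y\<bar> \<le> norm (x' - x) * R"
      using Cauchy_Schwarz_ineq2[of "x - x'" y] R(2)[OF that]
        mult_left_mono[OF R(2)[OF that], of "norm (x - x')"] by (simp add: norm_minus_commute)
    moreover have "\<bar>(x' \<bullet> x' - x \<bullet> x) / 2\<bar> = \<bar>x \<bullet> x - x' \<bullet> x'\<bar> / 2"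
      by simp
    ultimately show ?thesis
      unfolding B_def by linarith
  qed
  have Bsym: "B x x' = B x' x" for x x'
    by (simp add: B_def norm_minus_commute abs_minus_commute)
  have B0: "0 \<le> B x x'" for x x'
    using R by (simp add: B_def)
  have step: "p x \<le> p x' + B x x'" for x x'
  proof (rule lub)
    show "0 \<le> p x' + B x x'"
      using p0 B0 by (simp add: add_nonneg_nonneg)
    fix y assume y: "y \<in> T"
    show "lam - cost x y - q y \<le> p x' + B x x'"
      using ub[OF y, of x'] B[OF y, of x' x] by linarith
  qed
  have abs_le: "\<bar>p x - p x'\<bar> \<le> B x x'" for x x'
    using step[of x x'] step[of x' x] Bsym[of x x'] by linarith
  have "isCont p x'" for x'
  proof -
    have "((\<lambda>x. B x x') \<longlongrightarrow> B x' x') (at x')"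
      unfolding B_def by (intro tendsto_intros) auto
    then have "((\<lambda>x. B x x') \<longlongrightarrow> 0) (at x')"
      by (simp add: B_def)
    then have "((\<lambda>x. p x - p x') \<longlongrightarrow> 0) (at x')"
      by (rule Lim_null_comparison[rotated])
         (simp add: abs_le)
    then show ?thesis
      unfolding isCont_def by (subst (asm) LIM_zero_iff)
  qed
  then show ?thesis
    by (simp add: continuous_at_imp_continuous_on)
qed

section \<open>Common subgradients and locally constant differences\<close>

text \<open>The quadratic cost turns \<open>y\<close> into a subgradient at \<open>x\<close> of the convex function
  \<open>p + |\<cdot>|\<^sup>2/2\<close>.\<close>

definition supports_at :: "('a::euclidean_space \<Rightarrow> real) \<Rightarrow> 'a \<Rightarrow> 'a \<Rightarrow> bool" where
  "supports_at p x y \<longleftrightarrow> (\<forall>x'. p x + cost x y - cost x' y \<le> p x')"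

text \<open>Supports at the two endpoints enclose the increment of p in an interval that depends
  only on a, b, y and z, not on p, and has length (b - a) \<bullet> (z - y).\<close>

lemma supports_at_increment:
  assumes "supports_at p a y" "supports_at p b z"
  shows "(a \<bullet> a - b \<bullet> b) / 2 + (b - a) \<bullet> y \<le> p b - p a"
    and "p b - p a \<le> (a \<bullet> a - b \<bullet> b) / 2 + (b - a) \<bullet> z"
proof -
  have "p a + (cost a y - cost b y) \<le> p b"
    using assms(1) unfolding supports_at_def by (simp add: add_diff_eq)
  then show "(a \<bullet> a - b \<bullet> b) / 2 + (b - a) \<bullet> y \<le> p b - p a"
    unfolding cost_diff by linarith
  have "p b + (cost b z - cost a z) \<le> p a"
    using assms(2) unfolding supports_at_def by (simp add: add_diff_eq)
  then show "p b - p a \<le> (a \<bullet> a - b \<bullet> b) / 2 + (b - a) \<bullet> z"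
    using cost_diff[of a z b] by linarith
qed

text \<open>Cut the segment into N equal pieces. The error on a piece is at most 1/N times (b - a)
  \<bullet> (increment of Y); these errors telescope, so the total error is at most (b - a)
  \<bullet> (Y b - Y a) / N, which tends to 0. The selection Y may be discontinuous.\<close>

lemma common_supports_diff_const_on_segment:
  assumes Y: "\<And>x. x \<in> closed_segment a b \<Longrightarrow> supports_at p (x::'a::euclidean_space) (Y x) \<and> supports_at q x (Y x)"
  shows "p a - q a = p b - q b"
proof -
  define w where "w x = p x - q x" for x
  have bound: "real N * \<bar>w b - w a\<bar> \<le> (b - a) \<bullet> (Y b - Y a)" if N: "0 < N" for N :: nat
  proof -
    define X where "X k = a + (real k / real N) *\<^sub>R (b - a)" for k
    have X: "X k \<in> closed_segment a b" if "k \<le> N" for k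
      using that N unfolding in_segment
      by (intro exI[of _ "real k / real N"]) (auto simp: X_def algebra_simps)
    have XX: "X (Suc k) - X k = (1 / real N) *\<^sub>R (b - a)" for k
      by (simp add: X_def scaleR_diff_left[symmetric] diff_divide_distrib[symmetric])
    have step: "real N * \<bar>w (X (Suc k)) - w (X k)\<bar> \<le> (b - a) \<bullet> (Y (X (Suc k)) - Y (X k))"
      if "k < N" for k
    proof -
      have mem: "X k \<in> closed_segment a b" "X (Suc k) \<in> closed_segment a b"
        using X that by auto
      \<comment> \<open>The increments of p and q lie in the same interval, so they differ by at
        most its length.\<close>
      have "\<bar>w (X (Suc k)) - w (X k)\<bar> \<le> (X (Suc k) - X k) \<bullet> (Y (X (Suc k)) - Y (X k))"
        using supports_at_increment[of p "X k" "Y (X k)" "X (Suc k)" "Y (X (Suc k))"]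
          supports_at_increment[of q "X k" "Y (X k)" "X (Suc k)" "Y (X (Suc k))"]
          Y[OF mem(1)] Y[OF mem(2)]
        unfolding w_def inner_diff_right by linarith
      also have "\<dots> = ((b - a) \<bullet> (Y (X (Suc k)) - Y (X k))) / real N"
        by (simp add: XX)
      finally show ?thesis
        using N by (simp add: field_simps)
    qed
    have "\<bar>w b - w a\<bar> = \<bar>\<Sum>k<N. w (X (Suc k)) - w (X k)\<bar>"
      using N sum_lessThan_telescope[of "\<lambda>k. w (X k)" N] by (simp add: X_def)
    also have "\<dots> \<le> (\<Sum>k<N. \<bar>w (X (Suc k)) - w (X k)\<bar>)"
      by (rule sum_abs)
    finally have "real N * \<bar>w b - w a\<bar> \<le> real N * (\<Sum>k<N. \<bar>w (X (Suc k)) - w (X k)\<bar>)"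
      by (simp add: mult_left_mono)
    also have "\<dots> \<le> (\<Sum>k<N. (b - a) \<bullet> (Y (X (Suc k)) - Y (X k)))"
      unfolding sum_distrib_left by (intro sum_mono step) auto
    also have "\<dots> = (b - a) \<bullet> (\<Sum>k<N. Y (X (Suc k)) - Y (X k))"
      by (simp add: inner_sum_right)
    also have "(\<Sum>k<N. Y (X (Suc k)) - Y (X k)) = Y b - Y a"
      using N sum_lessThan_telescope[of "\<lambda>k. Y (X k)" N] by (simp add: X_def)
    finally show ?thesis .
  qed
  have "w b = w a"
  proof (rule ccontr)
    assume "w b \<noteq> w a"
    then obtain N where N: "(b - a) \<bullet> (Y b - Y a) < real N * \<bar>w b - w a\<bar>"
      using reals_Archimedean3[of "\<bar>w b - w a\<bar>"] by auto
    show False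
    proof (cases "N = 0")
      \<comment> \<open>The Archimedean choice may return 0. Then the inner product is negative,
        which the bound for a single piece excludes.\<close>
      case True
      then show False using N bound[of 1] by simp
    next
      case False
      then show False using N bound[of N] by simp
    qed
  qed
  then show ?thesis by (simp add: w_def)
qed

text \<open>If p - q had a positive value t in S, its level set would be relatively open and closed
  in S. By connectedness and continuity p - q would equal t on the closure of S, contrary to the
  point z.\<close>

lemma common_supports_comparison:
  fixes p q :: "'a::euclidean_space \<Rightarrow> real"
  assumes "open S" "connected S" and cont: "continuous_on UNIV p" "continuous_on UNIV q"
    and supp: "\<And>x. x \<in> S \<Longrightarrow> q x < p x \<Longrightarrow> \<exists>y. supports_at p x y \<and> supports_at q x y"
    and z: "z \<in> closure S" "p z \<le> q z"
    and x: "x \<in> S"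
  shows "p x \<le> q x"
proof (rule ccontr)
  assume "\<not> p x \<le> q x"
  define t where "t = p x - q x"
  have t: "0 < t" using \<open>\<not> p x \<le> q x\<close> by (simp add: t_def)
  let ?L = "{x. p x - q x = t}"
  have clL: "closed ?L"
    by (intro closed_Collect_eq continuous_intros cont)
  have "open (S \<inter> ?L)"
    unfolding open_contains_ball
  proof
    fix a assume a: "a \<in> S \<inter> ?L"
    have "open (S \<inter> {x. q x < p x})"
      by (intro open_Int open_Collect_less cont \<open>open S\<close>)
    moreover have "a \<in> S \<inter> {x. q x < p x}"
      using a t by auto
    ultimately obtain e where e: "0 < e" "ball a e \<subseteq> S \<inter> {x. q x < p x}"
      unfolding open_contains_ball by blast
    have "p b - q b = t" if b: "b \<in> ball a e" for b
    proof -
      \<comment> \<open>On a ball inside S where q < p, every point of a segment from the centre has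
        a common support, so p - q keeps its central value t.\<close>
      have "closed_segment a b \<subseteq> ball a e"
        using b e(1) by (simp add: closed_segment_subset)
      then have "\<forall>x\<in>closed_segment a b. \<exists>y. supports_at p x y \<and> supports_at q x y"
        using e(2) supp by blast
      then obtain Y where "\<And>x. x \<in> closed_segment a b \<Longrightarrow> supports_at p x (Y x) \<and> supports_at q x (Y x)"
        by metis
      from common_supports_diff_const_on_segment[OF this] show ?thesis
        using a by simp
    qed
    then show "\<exists>e>0. ball a e \<subseteq> S \<inter> ?L"
      using e by (intro exI[of _ e]) auto
  qed
  moreover have "open (S \<inter> - ?L)"
    using clL \<open>open S\<close> by (intro open_Int) auto
  moreover have "x \<in> S \<inter> ?L"
    using x by (simp add: t_def)
  ultimately have "S \<subseteq> ?L"
    using connectedD[OF \<open>connected S\<close>, of "S \<inter> ?L" "S \<inter> - ?L"] by blast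
  then have "closure S \<subseteq> ?L"
    using clL by (rule closure_minimal)
  then show False
    using z t by auto
qed

subsection \<open>Completion of partial plans\<close>

definition sum_measure :: "'a measure \<Rightarrow> 'a measure \<Rightarrow> 'a measure" where
  "sum_measure M N = measure_of (space M) (sets M) (\<lambda>A. emeasure M A + emeasure N A)"

lemma sets_sum_measure [simp]: "sets (sum_measure M N) = sets M"
  by (simp add: sum_measure_def)

lemma emeasure_sum_measure:
  assumes N: "sets N = sets M" and A: "A \<in> sets M"
  shows "emeasure (sum_measure M N) A = emeasure M A + emeasure N A"
  unfolding sum_measure_def
proof (rule emeasure_measure_of_sigma)
  show "sigma_algebra (space M) (sets M)" ..
  show "positive (sets M) (\<lambda>A. emeasure M A + emeasure N A)"
    by (simp add: positive_def)
  show "countably_additive (sets M) (\<lambda>A. emeasure M A + emeasure N A)"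
    by (rule countably_additiveI) (simp add: suminf_add[symmetric] suminf_emeasure N)
qed fact

section \<open>From augmented couplings to partial plans\<close>

text \<open>Restricting first discards the pairs containing \<open>Infty\<close>, whose mass
  \<open>the_fin\<close> would otherwise move to an arbitrary point.\<close>

definition finite_part :: "('a::euclidean_space aug \<times> 'a aug) measure \<Rightarrow> ('a \<times> 'a) measure" where
  "finite_part \<gamma> = distr (restrict_space \<gamma> (range Fin \<times> range Fin)) borel (map_prod the_fin the_fin)"

lemma measurable_map_prod_the_fin:
  fixes \<gamma> :: "('a::euclidean_space aug \<times> 'a aug) measure"
  assumes "sets \<gamma> = sets borel"
  shows "map_prod the_fin the_fin \<in> borel_measurable (restrict_space \<gamma> (range Fin \<times> range Fin))"
proof -
  have "continuous_on UNIV (\<lambda>p::'a aug \<times> 'a aug. (the_fin (fst p), the_fin (snd p)))"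
    by (intro continuous_intros continuous_on_compose2[OF continuous_on_the_fin]) auto
  then have "map_prod the_fin the_fin \<in> borel_measurable (borel :: ('a aug \<times> 'a aug) measure)"
    by (intro borel_measurable_continuous_onI) (simp add: map_prod_def case_prod_beta')
  then show ?thesis
    by (intro measurable_restrict_space1) (simp add: measurable_cong_sets[OF assms refl])
qed

lemma emeasure_finite_part:
  fixes \<gamma> :: "('a::euclidean_space aug \<times> 'a aug) measure"
  assumes \<gamma>: "sets \<gamma> = sets borel" and A: "A \<in> sets borel"
  shows "emeasure (finite_part \<gamma>) A = emeasure \<gamma> (map_prod Fin Fin ` A)"
proof -
  have sp: "space \<gamma> = UNIV"
    using sets_eq_imp_space_eq[OF \<gamma>] by simp
  have FF: "range Fin \<times> range Fin \<in> sets \<gamma>"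
    unfolding \<gamma> by (intro borel_open open_Times open_range_Fin)
  have "emeasure (finite_part \<gamma>) A = emeasure (restrict_space \<gamma> (range Fin \<times> range Fin))
      (map_prod the_fin the_fin -` A \<inter> space (restrict_space \<gamma> (range Fin \<times> range Fin)))"
    unfolding finite_part_def by (rule emeasure_distr[OF measurable_map_prod_the_fin[OF \<gamma>] A])
  also have "map_prod the_fin the_fin -` A \<inter> space (restrict_space \<gamma> (range Fin \<times> range Fin)) = map_prod Fin Fin ` A"
    by (force simp: space_restrict_space sp)
  also have "emeasure (restrict_space \<gamma> (range Fin \<times> range Fin)) (map_prod Fin Fin ` A) = emeasure \<gamma> (map_prod Fin Fin ` A)"
    by (rule emeasure_restrict_space) (use FF sp in auto)
  finally show ?thesis .
qed

text \<open>The augmented cost vanishes as soon as one coordinate is \<open>Infty\<close>, so only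
  the finite pairs contribute and the two problems have the same objective.\<close>

lemma integral_finite_part:
  fixes \<gamma> :: "('a::euclidean_space aug \<times> 'a aug) measure"
  assumes \<gamma>: "sets \<gamma> = sets borel"
  shows "(\<integral>p. (cost (fst p) (snd p) - lam) \<partial>finite_part \<gamma>) = (\<integral>p. aug_cost lam (fst p) (snd p) \<partial>\<gamma>)"
proof -
  let ?S = "range Fin \<times> range Fin :: ('a aug \<times> 'a aug) set"
  have sp: "space \<gamma> = UNIV"
    using sets_eq_imp_space_eq[OF \<gamma>] by simp
  have FF: "?S \<in> sets \<gamma>"
    unfolding \<gamma> by (intro borel_open open_Times open_range_Fin)
  have "(\<lambda>p. cost (fst p) (snd p) - lam) \<in> borel_measurable (borel :: ('a \<times> 'a) measure)"
    unfolding cost_def by (intro borel_measurable_continuous_onI continuous_intros) auto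
  then have "(\<integral>p. (cost (fst p) (snd p) - lam) \<partial>finite_part \<gamma>) =
      (\<integral>p. (cost (the_fin (fst p)) (the_fin (snd p)) - lam) \<partial>restrict_space \<gamma> ?S)"
    unfolding finite_part_def
    by (subst integral_distr[OF measurable_map_prod_the_fin[OF \<gamma>]]) auto
  also have "\<dots> = (\<integral>p. indicator ?S p *\<^sub>R (cost (the_fin (fst p)) (the_fin (snd p)) - lam) \<partial>\<gamma>)"
    by (rule integral_restrict_space) (use FF sp in auto)
  also have "(\<lambda>p. indicator ?S p *\<^sub>R (cost (the_fin (fst p)) (the_fin (snd p)) - lam)) =
      (\<lambda>p. aug_cost lam (fst p) (snd p))"
  proof
    fix p :: "'a aug \<times> 'a aug"
    show "indicator ?S p *\<^sub>R (cost (the_fin (fst p)) (the_fin (snd p)) - lam) =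
        aug_cost lam (fst p) (snd p)"
      by (cases "fst p"; cases "snd p") (auto simp: indicator_def aug_cost_def mem_Times_iff)
  qed
  finally show ?thesis .
qed

lemma finite_part_in_partial_plans:
  fixes f g :: "'a::euclidean_space \<Rightarrow> real"
  assumes \<gamma>: "\<gamma> \<in> couplings (aug_measure f r) (aug_measure g s)"
  shows "finite_part \<gamma> \<in> partial_plans f g"
proof -
  note c = couplingsD[OF \<gamma>]
  have sets_fp: "sets (finite_part \<gamma>) = sets borel" "space (finite_part \<gamma>) = UNIV"
    by (simp_all add: finite_part_def)
  have meas: "fst \<in> measurable (finite_part \<gamma>) borel" "snd \<in> measurable (finite_part \<gamma>) borel"
    by (auto simp: measurable_cong_sets[OF sets_fp(1) refl] intro!: borel_measurable_continuous_onI continuous_intros)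
  have bm: "A \<times> B \<in> sets borel" if "A \<in> sets borel" "B \<in> sets borel" for A B :: "'a set"
    using that by (simp add: borel_prod[symmetric])
  have bma: "A \<times> B \<in> sets borel" if "A \<in> sets borel" "B \<in> sets borel" for A B :: "'a aug set"
    using that by (simp add: borel_prod[symmetric])
  have "emeasure (distr (finite_part \<gamma>) borel fst) A \<le> emeasure (measure_of_density f) A" if A: "A \<in> sets borel" for A
  proof -
    have "emeasure (distr (finite_part \<gamma>) borel fst) A = emeasure (finite_part \<gamma>) (A \<times> UNIV)"
      using emeasure_distr[OF meas(1) A] by (simp add: sets_fp fst_vimage_eq_Times)
    also have "\<dots> = emeasure \<gamma> (map_prod Fin Fin ` (A \<times> UNIV))"
      by (rule emeasure_finite_part[OF c(1)]) (use bm A in auto)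
    also have "\<dots> \<le> emeasure \<gamma> (Fin ` A \<times> UNIV)"
      by (rule emeasure_mono) (use bma sets_image_Fin[OF A] in \<open>auto simp: c\<close>)
    also have "\<dots> = emeasure (aug_measure f r) (Fin ` A)"
      by (rule c(3)[OF sets_image_Fin[OF A]])
    also have "\<dots> = emeasure (measure_of_density f) A"
      using sets_image_Fin[OF A] by (subst emeasure_aug_measure) (auto simp: inj_vimage_image_eq inj_def indicator_def)
    finally show ?thesis .
  qed
  moreover have "emeasure (distr (finite_part \<gamma>) borel snd) A \<le> emeasure (measure_of_density g) A" if A: "A \<in> sets borel" for A
  proof -
    have "emeasure (distr (finite_part \<gamma>) borel snd) A = emeasure (finite_part \<gamma>) (UNIV \<times> A)"
      using emeasure_distr[OF meas(2) A] by (simp add: sets_fp snd_vimage_eq_Times)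
    also have "\<dots> = emeasure \<gamma> (map_prod Fin Fin ` (UNIV \<times> A))"
      by (rule emeasure_finite_part[OF c(1)]) (use bm A in auto)
    also have "\<dots> \<le> emeasure \<gamma> (UNIV \<times> Fin ` A)"
      by (rule emeasure_mono) (use bma sets_image_Fin[OF A] in \<open>auto simp: c\<close>)
    also have "\<dots> = emeasure (aug_measure g s) (Fin ` A)"
      by (rule c(4)[OF sets_image_Fin[OF A]])
    also have "\<dots> = emeasure (measure_of_density g) A"
      using sets_image_Fin[OF A] by (subst emeasure_aug_measure) (auto simp: inj_vimage_image_eq inj_def indicator_def)
    finally show ?thesis .
  qed
  ultimately show ?thesis
    by (simp add: partial_plans_def sets_fp)
qed

section \<open>From partial plans to augmented couplings\<close>

text \<open>The untransported mass is sent to, respectively received from, the point at infinity; the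
  atom at \<open>(Infty, Infty)\<close> restores the marginals and carries exactly the transported mass.\<close>

definition completed_plan ::
  "('a::euclidean_space \<Rightarrow> real) \<Rightarrow> ('a \<Rightarrow> real) \<Rightarrow> ('a \<times> 'a) measure \<Rightarrow> ('a aug \<times> 'a aug) measure" where
  "completed_plan f g \<gamma> =
     sum_measure
       (sum_measure (distr \<gamma> borel (map_prod Fin Fin)) (distr \<gamma> borel (\<lambda>_. (Infty, Infty))))
       (sum_measure
         (distr (diff_measure (measure_of_density f) (distr \<gamma> borel fst)) borel (\<lambda>x. (Fin x, Infty)))
         (distr (diff_measure (measure_of_density g) (distr \<gamma> borel snd)) borel (\<lambda>y. (Infty, Fin y))))"

context
  fixes f g :: "'a::euclidean_space \<Rightarrow> real" and \<gamma> :: "('a \<times> 'a) measure"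
  assumes \<gamma>: "\<gamma> \<in> partial_plans f g"
    and f1: "emeasure (measure_of_density f) UNIV = 1"
    and g1: "emeasure (measure_of_density g) UNIV = 1"
begin

lemma partial_plan_sets: "sets \<gamma> = sets borel" "space \<gamma> = UNIV"
  using \<gamma> sets_eq_imp_space_eq[of \<gamma> borel] by (auto simp: partial_plans_def)

lemma partial_plan_measurable [measurable]:
  "fst \<in> measurable \<gamma> borel" "snd \<in> measurable \<gamma> borel"
  by (auto simp: measurable_cong_sets[OF partial_plan_sets(1) refl]
      intro!: borel_measurable_continuous_onI continuous_intros)

lemma partial_plan_marginals_le:
  assumes A: "A \<in> sets borel"
  shows "emeasure \<gamma> (A \<times> UNIV) \<le> emeasure (measure_of_density f) A"
    and "emeasure \<gamma> (UNIV \<times> A) \<le> emeasure (measure_of_density g) A"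
    and "emeasure (distr \<gamma> borel fst) A = emeasure \<gamma> (A \<times> UNIV)"
    and "emeasure (distr \<gamma> borel snd) A = emeasure \<gamma> (UNIV \<times> A)"
proof -
  show 1: "emeasure (distr \<gamma> borel fst) A = emeasure \<gamma> (A \<times> UNIV)"
    using emeasure_distr[OF partial_plan_measurable(1) A] by (simp add: partial_plan_sets fst_vimage_eq_Times)
  show 2: "emeasure (distr \<gamma> borel snd) A = emeasure \<gamma> (UNIV \<times> A)"
    using emeasure_distr[OF partial_plan_measurable(2) A] by (simp add: partial_plan_sets snd_vimage_eq_Times)
  show "emeasure \<gamma> (A \<times> UNIV) \<le> emeasure (measure_of_density f) A"
    "emeasure \<gamma> (UNIV \<times> A) \<le> emeasure (measure_of_density g) A"
    using \<gamma> A unfolding 1[symmetric] 2[symmetric] by (auto simp: partial_plans_def)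
qed

lemma partial_plan_mass_le: "emeasure \<gamma> UNIV \<le> 1"
  using partial_plan_marginals_le(1)[of UNIV] f1 by simp

lemma finite_partial_plan: "finite_measure \<gamma>"
  using partial_plan_mass_le by (intro finite_measureI) (auto simp: partial_plan_sets top_unique)

lemma emeasure_residual:
  assumes A: "A \<in> sets borel"
  shows "emeasure (diff_measure (measure_of_density f) (distr \<gamma> borel fst)) A =
           emeasure (measure_of_density f) A - emeasure \<gamma> (A \<times> UNIV)"
    and "emeasure (diff_measure (measure_of_density g) (distr \<gamma> borel snd)) A =
           emeasure (measure_of_density g) A - emeasure \<gamma> (UNIV \<times> A)"
proof -
  have fin: "finite_measure (measure_of_density f)" "finite_measure (measure_of_density g)"
    "finite_measure (distr \<gamma> borel fst)" "finite_measure (distr \<gamma> borel snd)"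
    using f1 g1 finite_partial_plan
    by (auto intro!: finite_measure.finite_measure_distr finite_measureI[of "measure_of_density _"])
  show "emeasure (diff_measure (measure_of_density f) (distr \<gamma> borel fst)) A =
      emeasure (measure_of_density f) A - emeasure \<gamma> (A \<times> UNIV)"
    using A partial_plan_marginals_le by (subst emeasure_diff_measure[OF fin(1,3)]) auto
  show "emeasure (diff_measure (measure_of_density g) (distr \<gamma> borel snd)) A =
      emeasure (measure_of_density g) A - emeasure \<gamma> (UNIV \<times> A)"
    using A partial_plan_marginals_le by (subst emeasure_diff_measure[OF fin(2,4)]) auto
qed

text \<open>There is one summand for each of the four combinations of finite and infinite
  coordinates.\<close>

lemma emeasure_completed_plan:
  assumes A: "A \<in> sets borel"
  shows "emeasure (completed_plan f g \<gamma>) A =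
     emeasure \<gamma> (map_prod Fin Fin -` A) + emeasure \<gamma> UNIV * indicator A (Infty, Infty) +
     (emeasure (measure_of_density f) {x. (Fin x, Infty) \<in> A} - emeasure \<gamma> ({x. (Fin x, Infty) \<in> A} \<times> UNIV) +
     (emeasure (measure_of_density g) {y. (Infty, Fin y) \<in> A} - emeasure \<gamma> (UNIV \<times> {y. (Infty, Fin y) \<in> A})))"
proof -
  have m1: "map_prod Fin Fin \<in> measurable \<gamma> borel"
  proof -
    have "continuous_on UNIV (\<lambda>p::'a \<times> 'a. (Fin (fst p), Fin (snd p)))"
      by (intro continuous_intros continuous_on_compose2[OF continuous_on_Fin]) auto
    then show ?thesis
      unfolding measurable_cong_sets[OF partial_plan_sets(1) refl]
      by (intro borel_measurable_continuous_onI) (simp add: map_prod_def case_prod_beta')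
  qed
  have m2: "(\<lambda>x::'a. (Fin x, Infty)) \<in> borel_measurable borel" "(\<lambda>y::'a. (Infty, Fin y)) \<in> borel_measurable borel"
    by (intro borel_measurable_continuous_onI continuous_intros continuous_on_Fin)+
  have S: "{x. (Fin x, Infty) \<in> A} \<in> sets borel" "{y. (Infty, Fin y) \<in> A} \<in> sets borel"
    using measurable_sets[OF m2(1) A] measurable_sets[OF m2(2) A] by (simp_all add: vimage_def)
  have "emeasure (distr \<gamma> borel (map_prod Fin Fin)) A = emeasure \<gamma> (map_prod Fin Fin -` A)"
    using emeasure_distr[OF m1 A] by (simp add: partial_plan_sets)
  moreover have "emeasure (distr \<gamma> borel (\<lambda>_. (Infty, Infty))) A = emeasure \<gamma> UNIV * indicator A (Infty, Infty)"
    using A by (subst emeasure_distr) (auto simp: partial_plan_sets indicator_def)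
  moreover have "emeasure (distr (diff_measure (measure_of_density f) (distr \<gamma> borel fst)) borel (\<lambda>x. (Fin x, Infty))) A
      = emeasure (measure_of_density f) {x. (Fin x, Infty) \<in> A} - emeasure \<gamma> ({x. (Fin x, Infty) \<in> A} \<times> UNIV)"
    using A m2 S by (subst emeasure_distr) (auto simp: emeasure_residual vimage_def measurable_def)
  moreover have "emeasure (distr (diff_measure (measure_of_density g) (distr \<gamma> borel snd)) borel (\<lambda>y. (Infty, Fin y))) A
      = emeasure (measure_of_density g) {y. (Infty, Fin y) \<in> A} - emeasure \<gamma> (UNIV \<times> {y. (Infty, Fin y) \<in> A})"
    using A m2 S by (subst emeasure_distr) (auto simp: emeasure_residual vimage_def measurable_def)
  ultimately show ?thesis
    unfolding completed_plan_def using A by (simp add: emeasure_sum_measure)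
qed

lemma sets_completed_plan: "sets (completed_plan f g \<gamma>) = sets borel"
  by (simp add: completed_plan_def)

text \<open>Over finite points, transported and untransported mass add up to the density. Over
  \<open>Infty\<close>, the atom of mass \<open>emeasure \<gamma> UNIV\<close> and the residual mass
  of the other marginal add up to 1.\<close>

lemma completed_plan_in_couplings:
  "completed_plan f g \<gamma> \<in> couplings (aug_measure f 1) (aug_measure g 1)"
proof -
  let ?G = "completed_plan f g \<gamma>"
  have sp: "space ?G = UNIV"
    using sets_eq_imp_space_eq[OF sets_completed_plan] by simp
  have meas: "fst \<in> measurable ?G borel" "snd \<in> measurable ?G borel"
    by (auto simp: measurable_cong_sets[OF sets_completed_plan refl]
        intro!: borel_measurable_continuous_onI continuous_intros)
  have bma: "A \<times> B \<in> sets borel" if "A \<in> sets borel" "B \<in> sets borel" for A B :: "'a aug set"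
    using that by (simp add: borel_prod[symmetric])
  have Fv: "Fin -` A \<in> sets borel" if "A \<in> sets borel" for A :: "'a aug set"
    using measurable_sets[OF measurable_Fin that] by simp
  \<comment> \<open>Subtraction in \<open>ennreal\<close> is truncated; the domination of the
    marginals supplies the inequality required here.\<close>
  have cancel: "a + (b - a) = b" if "a \<le> b" for a b :: ennreal
    using that by (rule add_diff_inverse_ennreal)
  have "distr ?G borel fst = aug_measure f 1"
  proof (rule measure_eqI)
    fix A assume "A \<in> sets (distr ?G borel fst)"
    then have A: "A \<in> sets borel" by simp
    have "emeasure (distr ?G borel fst) A = emeasure ?G (A \<times> UNIV)"
      using emeasure_distr[OF meas(1) A] by (simp add: sp fst_vimage_eq_Times)
    also have "\<dots> = emeasure \<gamma> (Fin -` A \<times> UNIV) + emeasure \<gamma> UNIV * indicator A Infty +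
        (emeasure (measure_of_density f) (Fin -` A) - emeasure \<gamma> (Fin -` A \<times> UNIV) +
          (1 - emeasure \<gamma> UNIV) * indicator A Infty)"
    proof -
      have "map_prod Fin Fin -` (A \<times> UNIV) = Fin -` A \<times> (UNIV :: 'a set)" by auto
      then show ?thesis
        using bma[OF A, of UNIV] g1
        by (subst emeasure_completed_plan) (auto simp: indicator_def vimage_def)
    qed
    also have "\<dots> = (emeasure \<gamma> (Fin -` A \<times> UNIV) + (emeasure (measure_of_density f) (Fin -` A) - emeasure \<gamma> (Fin -` A \<times> UNIV)))
        + (emeasure \<gamma> UNIV + (1 - emeasure \<gamma> UNIV)) * indicator A Infty"
      by (simp only: distrib_right add.assoc add.commute add.left_commute)
    also have "\<dots> = emeasure (aug_measure f 1) A"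
      unfolding cancel[OF partial_plan_marginals_le(1)[OF Fv[OF A]]] cancel[OF partial_plan_mass_le]
      by (simp add: emeasure_aug_measure[OF A])
    finally show "emeasure (distr ?G borel fst) A = emeasure (aug_measure f 1) A" .
  qed simp
  moreover have "distr ?G borel snd = aug_measure g 1"
  proof (rule measure_eqI)
    fix A assume "A \<in> sets (distr ?G borel snd)"
    then have A: "A \<in> sets borel" by simp
    have "emeasure (distr ?G borel snd) A = emeasure ?G (UNIV \<times> A)"
      using emeasure_distr[OF meas(2) A] by (simp add: sp snd_vimage_eq_Times)
    also have "\<dots> = emeasure \<gamma> (UNIV \<times> Fin -` A) + emeasure \<gamma> UNIV * indicator A Infty +
        ((1 - emeasure \<gamma> UNIV) * indicator A Infty +
         (emeasure (measure_of_density g) (Fin -` A) - emeasure \<gamma> (UNIV \<times> Fin -` A)))"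
    proof -
      have "map_prod Fin Fin -` (UNIV \<times> A) = (UNIV :: 'a set) \<times> Fin -` A" by auto
      then show ?thesis
        using bma[OF _ A, of UNIV] f1
        by (subst emeasure_completed_plan) (auto simp: indicator_def vimage_def)
    qed
    also have "\<dots> = (emeasure \<gamma> (UNIV \<times> Fin -` A) + (emeasure (measure_of_density g) (Fin -` A) - emeasure \<gamma> (UNIV \<times> Fin -` A)))
        + (emeasure \<gamma> UNIV + (1 - emeasure \<gamma> UNIV)) * indicator A Infty"
      by (simp only: distrib_right add.assoc add.commute add.left_commute)
    also have "\<dots> = emeasure (aug_measure g 1) A"
      unfolding cancel[OF partial_plan_marginals_le(2)[OF Fv[OF A]]] cancel[OF partial_plan_mass_le]
      by (simp add: emeasure_aug_measure[OF A])
    finally show "emeasure (distr ?G borel snd) A = emeasure (aug_measure g 1) A" .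
  qed simp
  ultimately show ?thesis
    by (simp add: couplings_def sets_completed_plan)
qed

lemma finite_part_completed_plan: "finite_part (completed_plan f g \<gamma>) = \<gamma>"
proof (rule measure_eqI)
  show "sets (finite_part (completed_plan f g \<gamma>)) = sets \<gamma>"
    by (simp add: finite_part_def partial_plan_sets)
  fix A assume "A \<in> sets (finite_part (completed_plan f g \<gamma>))"
  then have A: "A \<in> sets borel" by (simp add: finite_part_def)
  \<comment> \<open>The image is rewritten as a preimage on an open subspace in order to see that it
    is Borel.\<close>
  have "map_prod Fin Fin ` A = map_prod the_fin the_fin -` A \<inter> space (restrict_space borel (range Fin \<times> range Fin))"
    by (force simp: space_restrict_space)
  also have "\<dots> \<in> sets (restrict_space borel (range Fin \<times> range Fin))"
    by (rule measurable_sets[OF measurable_map_prod_the_fin[OF refl] A])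
  finally have FA: "map_prod Fin Fin ` A \<in> sets borel"
    by (simp add: sets_restrict_space_iff borel_open[OF open_Times[OF open_range_Fin open_range_Fin]])
  have 1: "map_prod Fin Fin -` map_prod Fin Fin ` A = A"
    by (auto simp: map_prod_def)
  have 2: "{x. (Fin x, Infty) \<in> map_prod Fin Fin ` A} = {}" "{y. (Infty, Fin y) \<in> map_prod Fin Fin ` A} = {}"
    "(Infty, Infty) \<notin> map_prod Fin Fin ` A"
    by auto
  show "emeasure (finite_part (completed_plan f g \<gamma>)) A = emeasure \<gamma> A"
    unfolding emeasure_finite_part[OF sets_completed_plan A] emeasure_completed_plan[OF FA] 1 2(1,2)
    using 2(3) by (simp add: indicator_def)
qed

text \<open>A cheaper coupling would have a finite part that is a cheaper partial plan, since taking
  finite parts preserves the cost and undoes the completion.\<close>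

lemma optimal_completed_plan:
  assumes "optimal_partial_plan f g lam \<gamma>"
  shows "optimal_coupling (aug_cost lam) (aug_measure f 1) (aug_measure g 1) (completed_plan f g \<gamma>)"
  unfolding optimal_coupling_def is_arg_min_def
proof (intro conjI completed_plan_in_couplings notI, elim exE conjE)
  fix \<gamma>' assume \<gamma>': "\<gamma>' \<in> couplings (aug_measure f 1) (aug_measure g 1)"
    and less: "(\<integral>p. aug_cost lam (fst p) (snd p) \<partial>\<gamma>') < (\<integral>p. aug_cost lam (fst p) (snd p) \<partial>completed_plan f g \<gamma>)"
  have "(\<integral>p. (cost (fst p) (snd p) - lam) \<partial>finite_part \<gamma>') < (\<integral>p. (cost (fst p) (snd p) - lam) \<partial>\<gamma>)"
    using less integral_finite_part[OF couplingsD(1)[OF \<gamma>']]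
      integral_finite_part[OF sets_completed_plan] finite_part_completed_plan by simp
  then show False
    using assms finite_part_in_partial_plans[OF \<gamma>']
    unfolding optimal_partial_plan_def is_arg_min_def by blast
qed

text \<open>The transported mass sits as an atom at this pair. Its presence in the support forces
  the transform of the normalized potential to vanish at infinity.\<close>

lemma completed_plan_Infty_Infty:
  assumes "0 < measure \<gamma> UNIV"
  shows "(Infty, Infty) \<in> spt (completed_plan f g \<gamma>)"
proof -
  have "0 < emeasure \<gamma> UNIV"
    using assms finite_measure.emeasure_eq_measure[OF finite_partial_plan] by simp
  then show ?thesis
    by (auto simp: spt_def emeasure_completed_plan borel_open add_pos_nonneg add_nonneg_pos)
qed

text \<open>Untransported source mass is sent to \<open>Infty\<close>; a point found in its support
  will be a zero of the potential.\<close>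

lemma completed_plan_Fin_Infty:
  assumes "measure \<gamma> UNIV < 1"
  shows "\<exists>x. (Fin x, Infty) \<in> spt (completed_plan f g \<gamma>)"
proof -
  have S: "range Fin \<times> {Infty} \<in> sets (borel :: ('a aug \<times> 'a aug) measure)"
    by (intro borel_open open_Times open_range_Fin open_Infty)
  have "emeasure \<gamma> UNIV < 1"
    using assms finite_measure.emeasure_eq_measure[OF finite_partial_plan] by (simp add: ennreal_less_one_iff)
  then have "0 < 1 - emeasure \<gamma> UNIV"
    by (simp add: diff_gr0_ennreal)
  also have "\<dots> \<le> emeasure (completed_plan f g \<gamma>) (range Fin \<times> {Infty})"
    unfolding emeasure_completed_plan[OF S] by (simp add: f1 add_increasing)
  finally show ?thesis
    using emeasure_positive_meets_spt[OF sets_completed_plan S, of "\<lambda>_. True"] by auto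
qed

end

subsection \<open>Comparison of potentials\<close>

text \<open>The potentials \<open>p\<close>, \<open>q\<close> on the original space, both extended by \<open>0\<close> at the point at infinity.\<close>

locale contact_potentials =
  fixes lam :: real and S T :: "'a::euclidean_space set" and G :: "('a aug \<times> 'a aug) measure"
    and p q :: "'a \<Rightarrow> real"
  assumes p_nonneg: "0 \<le> p x" and q_nonneg: "0 \<le> q y"
    and dual_T: "y \<in> T \<Longrightarrow> lam - cost x y \<le> p x + q y"
    and dual_S: "x \<in> S \<Longrightarrow> lam - cost x y \<le> p x + q y"
    and continuous_p: "continuous_on A p" and continuous_q: "continuous_on B q"
    and contact: "(Fin x, Fin y) \<in> spt G \<Longrightarrow> x \<in> S \<and> y \<in> T \<and> p x + q y = lam - cost x y"
    and contact_right: "(Fin x, Infty) \<in> spt G \<Longrightarrow> x \<in> S \<and> p x = 0"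
    and contact_left: "(Infty, Fin y) \<in> spt G \<Longrightarrow> y \<in> T \<and> q y = 0"

lemma (in contact_potentials) contact_imp_supports_at:
  assumes "y \<in> T" "p x + q y = lam - cost x y"
  shows "supports_at p x y"
  unfolding supports_at_def
proof
  fix x'
  show "p x + cost x y - cost x' y \<le> p x'"
    using dual_T[OF assms(1), of x'] assms(2) by linarith
qed

text \<open>The potential and its transform both vanish at \<open>Infty\<close>, against which the
  cost is 0, so both are nonnegative. As the cost is at least \<open>-lam\<close>, both are at most
  \<open>lam\<close>; hence they are finite and can be replaced by real functions, which are suprema
  of the kind handled by \<open>continuous_on_sup_cost\<close>.\<close>

lemma exists_contact_potentials:
  fixes f g :: "'a::euclidean_space \<Rightarrow> real"
  defines "S \<equiv> spt (measure_of_density f)" and "T \<equiv> spt (measure_of_density g)"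
    and "\<mu> \<equiv> aug_measure f 1" and "\<nu> \<equiv> aug_measure g 1"
  assumes bdd: "bounded S" "bounded T" and lam: "0 \<le> lam"
    and G: "G \<in> couplings \<mu> \<nu>" "spt G \<subseteq> c_subdifferential (aug_cost lam) \<mu> U" "(Infty, Infty) \<in> spt G"
    and U: "c_convex (aug_cost lam) \<mu> \<nu> U" "U Infty = 0"
  shows "\<exists>p q. contact_potentials lam S T G p q \<and> (\<forall>x. U (Fin x) = ereal (p x))"
proof -
  define V where "V = c_transform (aug_cost lam) \<mu> U"
  have C_simps: "aug_cost lam (Fin x) (Fin y) = cost x y - lam" "aug_cost lam Infty b = 0" "aug_cost lam a Infty = 0" for x y a b
    by (auto simp: aug_cost_def split: aug.split)
  have C_le: "- aug_cost lam a b \<le> lam" for a b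
    using lam by (cases a; cases b) (auto simp: C_simps cost_nonneg)
  have Fin_spt: "Fin x \<in> spt \<mu> \<longleftrightarrow> x \<in> S" "Fin y \<in> spt \<nu> \<longleftrightarrow> y \<in> T" for x y
    by (simp_all add: \<mu>_def \<nu>_def S_def T_def Fin_in_spt_aug_measure)
  have Infty_spt: "Infty \<in> spt \<mu>" "Infty \<in> spt \<nu>"
    by (simp_all add: \<mu>_def \<nu>_def Infty_in_spt_aug_measure)
  have U_eq: "U a = (SUP b\<in>spt \<nu>. - ereal (aug_cost lam a b) - V b)" for a
    using U(1) unfolding c_convex_def V_def by blast
  have V_eq: "V b = (SUP a\<in>spt \<mu>. - ereal (aug_cost lam a b) - U a)" for b
    unfolding V_def c_transform_def ..
  have sub: "U a + V b = - ereal (aug_cost lam a b)" if "(a, b) \<in> spt G" for a b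
    using that G(2) unfolding V_def c_subdifferential_def by auto
  have V_Infty: "V Infty = 0"
    using sub[OF G(3)] U(2) by (simp add: C_simps)
  have U_ub: "- ereal (aug_cost lam a b) - V b \<le> U a" if "b \<in> spt \<nu>" for a b
    unfolding U_eq[of a] using that by (rule SUP_upper)
  have V_ub: "- ereal (aug_cost lam a b) - U a \<le> V b" if "a \<in> spt \<mu>" for a b
    unfolding V_eq[of b] using that by (rule SUP_upper)
  have U_nonneg: "0 \<le> U a" for a
    using U_ub[OF Infty_spt(2), of a] by (simp add: C_simps V_Infty zero_ereal_def[symmetric])
  have V_nonneg: "0 \<le> V b" for b
    using V_ub[OF Infty_spt(1), of b] by (simp add: C_simps U(2) zero_ereal_def[symmetric])
  have bnd: "- ereal c - v \<le> ereal lam" if "- c \<le> lam" "0 \<le> v" for c v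
    using that by (cases v) auto
  have U_le: "U a \<le> ereal lam" for a
    unfolding U_eq[of a] by (intro SUP_least bnd C_le V_nonneg)
  have V_le: "V b \<le> ereal lam" for b
    unfolding V_eq[of b] by (intro SUP_least bnd C_le U_nonneg)
  define p where "p x = real_of_ereal (U (Fin x))" for x
  define q where "q y = real_of_ereal (V (Fin y))" for y
  have p: "U (Fin x) = ereal (p x)" for x
    using U_nonneg[of "Fin x"] U_le[of "Fin x"] unfolding p_def by (cases "U (Fin x)") auto
  have q: "V (Fin y) = ereal (q y)" for y
    using V_nonneg[of "Fin y"] V_le[of "Fin y"] unfolding q_def by (cases "V (Fin y)") auto
  have p0: "0 \<le> p x" and q0: "0 \<le> q y" for x y
    using U_nonneg[of "Fin x"] V_nonneg[of "Fin y"] by (simp_all add: p q)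
  have p_ub: "lam - cost x y - q y \<le> p x" if "y \<in> T" for x y
    using U_ub[of "Fin y" "Fin x"] that by (simp add: p q C_simps Fin_spt)
  \<comment> \<open>The arguments of the cost are swapped so that
    \<open>continuous_on_sup_cost\<close> applies to q with y as the free variable.\<close>
  have q_ub: "lam - cost y x - p x \<le> q y" if "x \<in> S" for x y
    using V_ub[of "Fin x" "Fin y"] that cost_commute[of x y] by (simp add: p q C_simps Fin_spt)
  have p_lub: "p x \<le> K" if K: "0 \<le> K" "\<And>y. y \<in> T \<Longrightarrow> lam - cost x y - q y \<le> K" for x K
  proof -
    have "U (Fin x) \<le> ereal K"
      unfolding U_eq[of "Fin x"]
    proof (rule SUP_least)
      fix b assume "b \<in> spt \<nu>"
      then show "- ereal (aug_cost lam (Fin x) b) - V b \<le> ereal K"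
        using K by (cases b) (auto simp: C_simps Fin_spt q V_Infty)
    qed
    then show ?thesis by (simp add: p)
  qed
  have q_lub: "q y \<le> K" if K: "0 \<le> K" "\<And>x. x \<in> S \<Longrightarrow> lam - cost y x - p x \<le> K" for y K
  proof -
    have "V (Fin y) \<le> ereal K"
      unfolding V_eq[of "Fin y"]
    proof (rule SUP_least)
      fix a assume "a \<in> spt \<mu>"
      then show "- ereal (aug_cost lam a (Fin y)) - U a \<le> ereal K"
        using K cost_commute[of "the_fin a" y] by (cases a) (auto simp: C_simps Fin_spt p U(2))
    qed
    then show ?thesis by (simp add: q)
  qed
  have "contact_potentials lam S T G p q"
  proof
    show "continuous_on A p" for A
      by (rule continuous_on_sup_cost[OF bdd(2) p0 p_ub p_lub])
    show "continuous_on B q" for B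
      by (rule continuous_on_sup_cost[OF bdd(1) q0 q_ub q_lub])
    have mem: "a \<in> spt \<mu> \<and> b \<in> spt \<nu>" if "(a, b) \<in> spt G" for a b
      using that spt_coupling_subset[OF G(1)] by auto
    show "x \<in> S \<and> y \<in> T \<and> p x + q y = lam - cost x y" if "(Fin x, Fin y) \<in> spt G" for x y
      using mem[OF that] sub[OF that] by (simp add: Fin_spt p q C_simps)
    show "x \<in> S \<and> p x = 0" if "(Fin x, Infty) \<in> spt G" for x
      using mem[OF that] sub[OF that] by (simp add: Fin_spt p V_Infty C_simps)
    show "y \<in> T \<and> q y = 0" if "(Infty, Fin y) \<in> spt G" for y
      using mem[OF that] sub[OF that] by (simp add: Fin_spt q U(2) C_simps)
    \<comment> \<open>The two suprema run over different supports, so each yields the dual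
      inequality with only one of the two points restricted.\<close>
    show "lam - cost x y \<le> p x + q y" if "y \<in> T" for x y
      using p_ub[OF that, of x] by linarith
    show "lam - cost x y \<le> p x + q y" if "x \<in> S" for x y
      using q_ub[OF that, of y] cost_commute[of x y] by linarith
  qed (use p0 q0 in auto)
  then show ?thesis
    using p by blast
qed

text \<open>Positive transported mass gives the contact at (\<open>Infty\<close>,
  \<open>Infty\<close>) from which p and q are built; mass below 1 leaves source mass behind and so
  provides the zero z.\<close>

lemma normalized_potential_contact:
  fixes f g :: "'a::euclidean_space \<Rightarrow> real"
  assumes f1: "emeasure (measure_of_density f) UNIV = 1" "(\<integral>x. \<bar>f x\<bar> \<partial>lborel) = 1"
    and g1: "emeasure (measure_of_density g) UNIV = 1" "(\<integral>x. \<bar>g x\<bar> \<partial>lborel) = 1"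
    and bdd: "bounded (spt (measure_of_density f))" "bounded (spt (measure_of_density g))"
    and lam: "0 \<le> lam"
    and \<gamma>: "optimal_partial_plan f g lam \<gamma>" "0 < measure \<gamma> UNIV" "measure \<gamma> UNIV < 1"
    and u: "normalized_potential f g lam u"
  obtains G p q z where "G \<in> couplings (aug_measure f 1) (aug_measure g 1)"
    and "contact_potentials lam (spt (measure_of_density f)) (spt (measure_of_density g)) G p q"
    and "\<And>x. u x = ereal (p x)" and "z \<in> spt (measure_of_density f)" "p z = 0"
proof -
  let ?G = "completed_plan f g \<gamma>"
  have plan: "\<gamma> \<in> partial_plans f g"
    using \<gamma>(1) by (simp add: optimal_partial_plan_def is_arg_min_def)
  note plan_facts = plan f1(1) g1(1)
  obtain U where U: "normalized_aug_potential f g lam U" and uU: "u = U \<circ> Fin"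
    using u unfolding normalized_potential_def by blast
  have src: "aug_source f g = aug_measure f 1" "aug_target f g = aug_measure g 1"
    using f1 g1 by (simp_all add: aug_source_def aug_target_def)
  have G: "?G \<in> couplings (aug_measure f 1) (aug_measure g 1)"
    by (rule completed_plan_in_couplings[OF plan_facts])
  have "spt ?G \<subseteq> c_subdifferential (aug_cost lam) (aug_measure f 1) U"
    using U optimal_completed_plan[OF plan_facts \<gamma>(1)]
    unfolding normalized_aug_potential_def src by blast
  moreover have "c_convex (aug_cost lam) (aug_measure f 1) (aug_measure g 1) U" "U Infty = 0"
    using U unfolding normalized_aug_potential_def src by auto
  ultimately obtain p q
    where pq: "contact_potentials lam (spt (measure_of_density f)) (spt (measure_of_density g)) ?G p q"
      and p: "\<forall>x. U (Fin x) = ereal (p x)"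
    using exists_contact_potentials[OF bdd lam G _ completed_plan_Infty_Infty[OF plan_facts \<gamma>(2)]]
    by blast
  obtain z where "(Fin z, Infty) \<in> spt ?G"
    using completed_plan_Fin_Infty[OF plan_facts \<gamma>(3)] by blast
  then have "z \<in> spt (measure_of_density f)" "p z = 0"
    using contact_potentials.contact_right[OF pq] by auto
  with that[OF G pq] p uU show thesis
    by simp
qed

section \<open>Contact points common to both parameters\<close>

text \<open>At a contact pair of \<open>G\<^sub>1\<close>, duality for the second parameter bounds
  the difference of the p's by the shifted difference of the q's. The exchange lemma at every level
  t gives the reverse inequality almost everywhere, and equality is contact for the second
  parameter.\<close>

lemma AE_common_contact:
  fixes G\<^sub>1 G\<^sub>2 :: "('a::euclidean_space aug \<times> 'a aug) measure"
  assumes G: "G\<^sub>1 \<in> couplings \<mu> \<nu>" "G\<^sub>2 \<in> couplings \<mu> \<nu>" and fin: "emeasure \<mu> UNIV < \<infinity>"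
    and 1: "contact_potentials lam\<^sub>1 S T G\<^sub>1 p\<^sub>1 q\<^sub>1" and 2: "contact_potentials lam\<^sub>2 S T G\<^sub>2 p\<^sub>2 q\<^sub>2"
    and lam: "lam\<^sub>1 \<le> lam\<^sub>2"
  shows "AE r in G\<^sub>1. \<forall>x. fst r = Fin x \<and> p\<^sub>2 x < p\<^sub>1 x \<longrightarrow>
    (\<exists>y\<in>T. p\<^sub>1 x + q\<^sub>1 y = lam\<^sub>1 - cost x y \<and> p\<^sub>2 x + q\<^sub>2 y = lam\<^sub>2 - cost x y)"
proof -
  interpret P1: contact_potentials lam\<^sub>1 S T G\<^sub>1 p\<^sub>1 q\<^sub>1 by (rule 1)
  interpret P2: contact_potentials lam\<^sub>2 S T G\<^sub>2 p\<^sub>2 q\<^sub>2 by (rule 2)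
  define E where "E t = Fin ` {x. t < p\<^sub>1 x - p\<^sub>2 x}" for t
  define F where "F t = Fin ` {y. t < q\<^sub>2 y - q\<^sub>1 y - (lam\<^sub>2 - lam\<^sub>1)}" for t
  have sets: "E t \<in> sets borel" "F t \<in> sets borel" for t
    unfolding E_def F_def
    by (intro borel_open open_image_Fin open_Collect_less continuous_intros
        P1.continuous_p P2.continuous_p P1.continuous_q P2.continuous_q)+
  have fwd: "b \<in> F t" if "0 \<le> t" "(a, b) \<in> spt G\<^sub>1" "a \<in> E t" for a b t
  proof -
    obtain x where x: "a = Fin x" "t < p\<^sub>1 x - p\<^sub>2 x"
      using \<open>a \<in> E t\<close> by (auto simp: E_def)
    show ?thesis
    proof (cases b)
      case (Fin y)
      then show ?thesis
        using P1.contact[of x y] P2.dual_T[of y x] that x by (auto simp: F_def)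
    next
      \<comment> \<open>Mass of \<open>E t\<close> cannot go to infinity: there
        \<open>p\<^sub>1\<close> would vanish, while \<open>p\<^sub>2\<close> is nonnegative and t
        \<ge> 0.\<close>
      case Infty
      then show ?thesis
        using P1.contact_right[of x] P2.p_nonneg[of x] that x by auto
    qed
  qed
  have bwd: "a \<in> E t" if "0 \<le> t" "(a, b) \<in> spt G\<^sub>2" "b \<in> F t" for a b t
  proof -
    obtain y where y: "b = Fin y" "t < q\<^sub>2 y - q\<^sub>1 y - (lam\<^sub>2 - lam\<^sub>1)"
      using \<open>b \<in> F t\<close> by (auto simp: F_def)
    show ?thesis
    proof (cases a)
      case (Fin x)
      then show ?thesis
        using P2.contact[of x y] P1.dual_S[of x y] that y by (auto simp: E_def)
    next
      \<comment> \<open>Here the order of the parameters enters: with \<open>q\<^sub>2 y = 0\<close>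
        and \<open>q\<^sub>1 y\<close> nonnegative, the quantity defining \<open>F t\<close> is at
        most 0.\<close>
      case Infty
      then show ?thesis
        using P2.contact_left[of y] P1.q_nonneg[of y] that y lam by auto
    qed
  qed
  note spt1 = AE_in_spt[OF couplingsD(1)[OF G(1)]] and spt2 = AE_in_spt[OF couplingsD(1)[OF G(2)]]
  have "AE r in G\<^sub>1. snd r \<in> F t \<longrightarrow> fst r \<in> E t" if "0 \<le> t" for t
  proof (rule coupling_exchange[OF G fin sets])
    show "AE r in G\<^sub>1. fst r \<in> E t \<longrightarrow> snd r \<in> F t"
      using spt1 by eventually_elim (use fwd[OF that] in auto)
    show "AE r in G\<^sub>2. snd r \<in> F t \<longrightarrow> fst r \<in> E t"
      using spt2 by eventually_elim (use bwd[OF that] in auto)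
  qed
  \<comment> \<open>Rational levels allow a single null set for all t, and they still separate any
    two distinct real values.\<close>
  then have "AE r in G\<^sub>1. \<forall>t\<in>{t\<in>\<rat>. 0 \<le> t}. snd r \<in> F t \<longrightarrow> fst r \<in> E t"
    by (subst AE_ball_countable) (auto intro: countable_subset[OF _ countable_rat])
  with spt1 show ?thesis
  proof eventually_elim
    case (elim r)
    show ?case
    proof (intro allI impI, elim conjE)
      fix x assume x: "fst r = Fin x" "p\<^sub>2 x < p\<^sub>1 x"
      then have r: "(Fin x, snd r) \<in> spt G\<^sub>1"
        using elim(1) by (metis prod.collapse)
      obtain y where y: "snd r = Fin y"
        using r P1.contact_right[of x] P2.p_nonneg[of x] x(2) by (cases "snd r") auto
      have c: "x \<in> S" "y \<in> T" "p\<^sub>1 x + q\<^sub>1 y = lam\<^sub>1 - cost x y"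
        using P1.contact r y by auto
      have "q\<^sub>2 y - q\<^sub>1 y - (lam\<^sub>2 - lam\<^sub>1) \<le> p\<^sub>1 x - p\<^sub>2 x"
      proof (rule ccontr)
        assume "\<not> ?thesis"
        then obtain t where t: "t \<in> \<rat>" "p\<^sub>1 x - p\<^sub>2 x < t" "t < q\<^sub>2 y - q\<^sub>1 y - (lam\<^sub>2 - lam\<^sub>1)"
          using Rats_dense_in_real[of "p\<^sub>1 x - p\<^sub>2 x" "q\<^sub>2 y - q\<^sub>1 y - (lam\<^sub>2 - lam\<^sub>1)"] by auto
        then have "fst r \<in> E t"
          using elim(2) x y by (auto simp: F_def)
        then show False
          using x t by (auto simp: E_def)
      qed
      then have "p\<^sub>2 x + q\<^sub>2 y = lam\<^sub>2 - cost x y"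
        using P2.dual_T[OF c(2), of x] c(3) by linarith
      then show "\<exists>y\<in>T. p\<^sub>1 x + q\<^sub>1 y = lam\<^sub>1 - cost x y \<and> p\<^sub>2 x + q\<^sub>2 y = lam\<^sub>2 - cost x y"
        using c by blast
    qed
  qed
qed

text \<open>Passes from almost every point to every point: the set of points with a common contact
  is closed, and it meets every neighbourhood of x because such neighbourhoods carry positive
  mass.\<close>

lemma exists_common_contact:
  fixes f g :: "'a::euclidean_space \<Rightarrow> real"
  defines "S \<equiv> spt (measure_of_density f)"
  assumes G: "G\<^sub>1 \<in> couplings (aug_measure f 1) \<nu>" "G\<^sub>2 \<in> couplings (aug_measure f 1) \<nu>"
    and fin: "emeasure (measure_of_density f) UNIV < \<infinity>"
    and 1: "contact_potentials lam\<^sub>1 S T G\<^sub>1 p\<^sub>1 q\<^sub>1" and 2: "contact_potentials lam\<^sub>2 S T G\<^sub>2 p\<^sub>2 q\<^sub>2"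
    and lam: "lam\<^sub>1 \<le> lam\<^sub>2" and T: "compact T" and W: "open W" "W \<subseteq> S"
    and x: "x \<in> W" "p\<^sub>2 x < p\<^sub>1 x"
  shows "\<exists>y\<in>T. p\<^sub>1 x + q\<^sub>1 y = lam\<^sub>1 - cost x y \<and> p\<^sub>2 x + q\<^sub>2 y = lam\<^sub>2 - cost x y"
proof -
  interpret P1: contact_potentials lam\<^sub>1 S T G\<^sub>1 p\<^sub>1 q\<^sub>1 by (rule 1)
  interpret P2: contact_potentials lam\<^sub>2 S T G\<^sub>2 p\<^sub>2 q\<^sub>2 by (rule 2)
  note c1 = couplingsD[OF G(1)]
  \<comment> \<open>Pairs are ordered (y, x) because \<open>closed_compact_projection\<close>
    eliminates the first coordinate, which ranges over the compact set T.\<close>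
  define C where "C = {r. p\<^sub>1 (snd r) + q\<^sub>1 (fst r) = lam\<^sub>1 - cost (snd r) (fst r) \<and>
    p\<^sub>2 (snd r) + q\<^sub>2 (fst r) = lam\<^sub>2 - cost (snd r) (fst r)}"
  define D where "D = {x. \<exists>y. y \<in> T \<and> (y, x) \<in> C}"
  have D: "x \<in> D \<longleftrightarrow> (\<exists>y\<in>T. p\<^sub>1 x + q\<^sub>1 y = lam\<^sub>1 - cost x y \<and> p\<^sub>2 x + q\<^sub>2 y = lam\<^sub>2 - cost x y)" for x
    by (auto simp: D_def C_def)
  have comp: "continuous_on UNIV (\<lambda>r::'a \<times> 'a. h (fst r))" "continuous_on UNIV (\<lambda>r::'a \<times> 'a. h (snd r))"
    if "continuous_on UNIV h" for h :: "'a \<Rightarrow> real"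
    by (intro continuous_on_compose2[OF that] continuous_intros; simp)+
  have "closed C"
    unfolding C_def cost_def
    by (intro closed_Collect_conj closed_Collect_eq continuous_intros comp
        P1.continuous_p P2.continuous_p P1.continuous_q P2.continuous_q) auto
  then have "closed D"
    unfolding D_def by (rule closed_compact_projection[OF T])
  moreover have "x \<in> closure D"
    unfolding closure_approachable
  proof (intro allI impI)
    fix e :: real assume e: "0 < e"
    define N where "N = W \<inter> {x. p\<^sub>2 x < p\<^sub>1 x} \<inter> ball x e"
    have N: "open N" "x \<in> N"
      unfolding N_def using W x e
      by (auto intro!: open_Int open_Collect_less P1.continuous_p P2.continuous_p)
    have "0 < emeasure (measure_of_density f) N"
      using N W x unfolding S_def by (auto simp: spt_def)
    also have "\<dots> = emeasure (aug_measure f 1) (Fin ` N)"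
      using N(1) by (subst emeasure_aug_measure)
        (auto simp: borel_open open_image_Fin inj_vimage_image_eq inj_def indicator_def)
    also have "\<dots> = emeasure G\<^sub>1 (Fin ` N \<times> UNIV)"
      using N(1) by (simp add: c1 borel_open open_image_Fin)
    finally have pos: "0 < emeasure G\<^sub>1 (Fin ` N \<times> UNIV)" .
    have "emeasure (aug_measure f 1) UNIV < \<infinity>"
      using fin by (subst emeasure_aug_measure) auto
    note ae = AE_common_contact[OF G this 1 2 lam]
    have "Fin ` N \<times> (UNIV :: 'a aug set) \<in> sets borel"
      by (intro borel_open open_Times open_image_Fin N(1) open_UNIV)
    then obtain r where
      r: "r \<in> Fin ` N \<times> (UNIV :: 'a aug set)" "\<forall>x. fst r = Fin x \<and> p\<^sub>2 x < p\<^sub>1 x \<longrightarrow>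
        (\<exists>y\<in>T. p\<^sub>1 x + q\<^sub>1 y = lam\<^sub>1 - cost x y \<and> p\<^sub>2 x + q\<^sub>2 y = lam\<^sub>2 - cost x y)"
      by (rule emeasure_positive_meets_spt[OF c1(1) _ pos ae]) (rule that)
    then obtain x' where x': "fst r = Fin x'" "x' \<in> N"
      by auto
    with r(2) have "x' \<in> D"
      by (simp add: D N_def)
    then show "\<exists>y\<in>D. dist y x < e"
      using x'(2) by (auto simp: N_def dist_commute)
  qed
  ultimately show ?thesis
    by (simp add: D[symmetric])
qed

section \<open>Mass normalization and comparison on the domain\<close>

text \<open>The first form makes the densities probability measures; the second identifies the
  weight of the atoms in \<open>aug_source\<close> and \<open>aug_target\<close> as 1.\<close>

lemma nonneg_density_total_mass:
  fixes f :: "'a::euclidean_space \<Rightarrow> real"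
  assumes "integrable lborel f" "AE x in lborel. 0 \<le> f x" "(\<integral>x. f x \<partial>lborel) = 1"
  shows "emeasure (measure_of_density f) UNIV = 1" and "(\<integral>x. \<bar>f x\<bar> \<partial>lborel) = 1"
proof -
  have [measurable]: "f \<in> borel_measurable borel"
    using borel_measurable_integrable[OF assms(1)] by simp
  show "emeasure (measure_of_density f) UNIV = 1"
    using nn_integral_eq_integral[OF assms(1,2)] assms(3) by (simp add: emeasure_density)
  have "(\<integral>x. \<bar>f x\<bar> \<partial>lborel) = (\<integral>x. f x \<partial>lborel)"
    using assms(2) by (intro integral_cong_AE) auto
  then show "(\<integral>x. \<bar>f x\<bar> \<partial>lborel) = 1"
    using assms(3) by simp
qed

theorem theorem6p1:
  fixes \<Omega> \<Lambda> :: "(real ^ 'n) set"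
    and f g :: "real ^ 'n \<Rightarrow> real"
    and \<delta> \<beta>\<^sub>1 \<beta>\<^sub>2 lam\<^sub>1 lam\<^sub>2 :: real
    and \<gamma>\<^sub>1 \<gamma>\<^sub>2 :: "((real ^ 'n) \<times> (real ^ 'n)) measure"
    and u\<^sub>1 u\<^sub>2 :: "real ^ 'n \<Rightarrow> ereal"
  assumes "smooth_bounded_domain \<Omega>" and "smooth_bounded_domain \<Lambda>"
    and "hyperplane_separates \<Omega> \<Lambda>"
    and "\<delta> > 0" and "\<forall>x\<in>\<Omega>. \<forall>y\<in>\<Lambda>. norm (x - y) \<ge> \<delta>"
    and "integrable lborel f" and "integrable lborel g"
    and "AE x in lborel. 0 \<le> f x" and "AE y in lborel. 0 \<le> g y"
    and "(\<integral>x. f x \<partial>lborel) = 1" and "(\<integral>y. g y \<partial>lborel) = 1"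
    and "spt (measure_of_density f) = closure \<Omega>" and "spt (measure_of_density g) = closure \<Lambda>"
    and "\<beta>\<^sub>1 > 0" and "\<beta>\<^sub>2 > 0"
    and "AE x in lborel. x \<in> \<Omega> \<longrightarrow> \<beta>\<^sub>1 \<le> f x \<and> f x \<le> \<beta>\<^sub>2"
    and "AE y in lborel. y \<in> \<Lambda> \<longrightarrow> \<beta>\<^sub>1 \<le> g y \<and> g y \<le> \<beta>\<^sub>2"
    and "0 < lam\<^sub>1" and "lam\<^sub>1 < lam\<^sub>2"
    and "optimal_partial_plan f g lam\<^sub>1 \<gamma>\<^sub>1" and "optimal_partial_plan f g lam\<^sub>2 \<gamma>\<^sub>2"
    and "0 < measure \<gamma>\<^sub>1 UNIV" and "measure \<gamma>\<^sub>1 UNIV < measure \<gamma>\<^sub>2 UNIV" and "measure \<gamma>\<^sub>2 UNIV < 1"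
    and "normalized_potential f g lam\<^sub>1 u\<^sub>1" and "normalized_potential f g lam\<^sub>2 u\<^sub>2"
  shows "\<forall>x\<in>\<Omega>. u\<^sub>1 x \<le> u\<^sub>2 x"
proof
  fix x assume x: "x \<in> \<Omega>"
  let ?S = "spt (measure_of_density f)" and ?T = "spt (measure_of_density g)"
  have dom: "open \<Omega>" "connected \<Omega>" "bounded \<Omega>" "bounded \<Lambda>"
    using assms(1,2) by (auto simp: smooth_bounded_domain_def)
  have S: "?S = closure \<Omega>" "bounded ?S" and T: "bounded ?T" "compact ?T"
    using assms(12,13) dom by auto
  note f1 = nonneg_density_total_mass[OF assms(6,8,10)]
    and g1 = nonneg_density_total_mass[OF assms(7,9,11)]
  have lams: "0 \<le> lam\<^sub>1" "0 \<le> lam\<^sub>2" "lam\<^sub>1 \<le> lam\<^sub>2"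
    using assms(18,19) by auto
  have mass: "measure \<gamma>\<^sub>1 UNIV < 1" "0 < measure \<gamma>\<^sub>2 UNIV"
    using assms(22-24) by auto
  obtain G\<^sub>1 p\<^sub>1 q\<^sub>1 z where 1: "G\<^sub>1 \<in> couplings (aug_measure f 1) (aug_measure g 1)"
      "contact_potentials lam\<^sub>1 ?S ?T G\<^sub>1 p\<^sub>1 q\<^sub>1" "\<And>x. u\<^sub>1 x = ereal (p\<^sub>1 x)"
    and z: "z \<in> ?S" "p\<^sub>1 z = 0"
    by (rule normalized_potential_contact[OF f1 g1 S(2) T(1) lams(1) assms(20,22) mass(1) assms(25)])
       (rule that)
  obtain G\<^sub>2 p\<^sub>2 q\<^sub>2 where 2: "G\<^sub>2 \<in> couplings (aug_measure f 1) (aug_measure g 1)"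
      "contact_potentials lam\<^sub>2 ?S ?T G\<^sub>2 p\<^sub>2 q\<^sub>2" "\<And>x. u\<^sub>2 x = ereal (p\<^sub>2 x)"
    by (rule normalized_potential_contact[OF f1 g1 S(2) T(1) lams(2) assms(21) mass(2) assms(24,26)])
       (rule that)
  interpret P1: contact_potentials lam\<^sub>1 ?S ?T G\<^sub>1 p\<^sub>1 q\<^sub>1 by (rule 1)
  interpret P2: contact_potentials lam\<^sub>2 ?S ?T G\<^sub>2 p\<^sub>2 q\<^sub>2 by (rule 2)
  have "p\<^sub>1 x \<le> p\<^sub>2 x"
  proof (rule common_supports_comparison[OF dom(1,2) P1.continuous_p P2.continuous_p _ _ _ x])
    \<comment> \<open>At the zero z of \<open>p\<^sub>1\<close> the comparison is just the
      nonnegativity of \<open>p\<^sub>2\<close>.\<close>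
    show "z \<in> closure \<Omega>" "p\<^sub>1 z \<le> p\<^sub>2 z"
      using z P2.p_nonneg S(1) by auto
    fix a assume a: "a \<in> \<Omega>" "p\<^sub>2 a < p\<^sub>1 a"
    have "emeasure (measure_of_density f) UNIV < \<infinity>"
      by (simp add: f1)
    moreover have "\<Omega> \<subseteq> ?S"
      using S(1) closure_subset by auto
    ultimately obtain y where "y \<in> ?T" "p\<^sub>1 a + q\<^sub>1 y = lam\<^sub>1 - cost a y" "p\<^sub>2 a + q\<^sub>2 y = lam\<^sub>2 - cost a y"
      using exists_common_contact[OF 1(1) 2(1) _ 1(2) 2(2) lams(3) T(2) dom(1) _ a] by blast
    then show "\<exists>y. supports_at p\<^sub>1 a y \<and> supports_at p\<^sub>2 a y"
      using P1.contact_imp_supports_at P2.contact_imp_supports_at by blast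
  qed
  then show "u\<^sub>1 x \<le> u\<^sub>2 x"
    by (simp add: 1 2)
qed

end
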